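(* Let $\mathcal{H}\subset\mathcal{O}$ be a family of Hoffman graphs with $\mathfrak{h}_2\in\mathcal{H}$, and let $N\geq 7$ be an integer. If every connected slim $\mathcal{H}$-line graph of order $N$ has exactly one strict $\bar{\mathcal{H}}$-cover up to equivalence, then every connected slim $\mathcal{H}$-line graph of order at least $N$ has exactly one strict $\bar{\mathcal{H}}$-cover up to equivalence.
   Context: All graphs are finite, simple and undirected. A Hoffman graph $\mathfrak{h}=(H,\mu)$ is a graph $H$ with a labeling $\mu:V(H)\to\{f,s\}$ such that every vertex labeled $f$ (a fat vertex) is adjacent to at least one vertex labeled $s$ (a slim vertex), and fat vertices are pairwise non-adjacent. $V_s(\mathfrak{h})$, $V_f(\mathfrak{h})$ denote the sets of slim and fat vertices, and $N^f_{\mathfrak{h}}(x)$ the set of fat neighbours of $x$; $x\sim y$ means adjacency. A Hoffman subgraph is an induced subgraph with the restricted labeling. An ordinary graph is regarded as a Hoffman graph with no fat vertices (a slim graph); the order of a slim graph is its number of vertices. $\mathfrak{h}$ is fat if every slim vertex has a fat neighbour. Isomorphisms of Hoffman graphs are graph isomorphisms preserving labels; membership of a Hoffman graph in a family is meant up to isomorphism. Sum: for Hoffman subgraphs $\mathfrak{h}^1,\dots,\mathfrak{h}^k$ of $\mathfrak{h}$ we write $\mathfrak{h}=\bigoplus_i\mathfrak{h}^i$ if (i) $V(\mathfrak{h})=\bigcup_i V(\mathfrak{h}^i)$; (ii) $V_s(\mathfrak{h})$ is the disjoint union of the $V_s(\mathfrak{h}^i)$; (iii) $N^f_{\mathfrak{h}^i}(x)=N^f_{\mathfrak{h}}(x)$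 for every $x\in V_s(\mathfrak{h}^i)$; (iv) for $x\in V_s(\mathfrak{h}^i)$, $y\in V_s(\mathfrak{h}^j)$, $i\neq j$: $|N^f_{\mathfrak{h}}(x)\cap N^f_{\mathfrak{h}}(y)|\le 1$, with equality iff $x\sim y$. $\mathfrak{h}$ is decomposable if it is the sum of two non-empty Hoffman subgraphs, otherwise indecomposable. $\mathfrak{h}_2$ is the Hoffman graph with one slim vertex adjacent to two fat vertices. $\mathcal{O}$ is the family consisting of $\mathfrak{h}_2$ and all indecomposable fat Hoffman graphs with at least two slim vertices and exactly one fat vertex. For $\mathcal{H}\subset\mathcal{O}$, $\bar{\mathcal{H}}=\{\mathfrak{h}_2\}\cup\{\mathfrak{h}\in\mathcal{O}:\mathfrak{h}\text{ is a Hoffman subgraph of an element of }\mathcal{H}\}$. A Hoffman graph $\mathfrak{g}$ is an $\mathcal{H}$-line Hoffman graph if it is a Hoffman subgraph of some $\mathfrak{h}=\bigoplus_i\mathfrak{h}^i$ with all $\mathfrak{h}^i\in\mathcal{H}$; such $\mathfrak{h}$ is an $\mathcal{H}$-cover of $\mathfrak{g}$, strict if $V_s(\mathfrak{h})=V_s(\mathfrak{g})$. A slim $\mathcal{H}$-line graph is an $\mathcal{H}$-line Hoffman graph with no fat vertices. Two strict $\mathcal{H}$-covers $\mathfrak{h},\mathfrak{h}'$ of $\mathfrak{g}$ are equivalent if there is an isomorphism $\varphi:\mathfrak{h}\to\mathfrak{h}'$ whose restriction to $V(\mathfrak{g})$ is the identity. *)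

theory Defs
  imports Main "HOL-Library.Infinite_Typeclass"
begin

text \<open>The labelling is encoded by the two sets of slim and fat vertices; the edge relation
  contains both orientations of every edge.\<close>

record 'a hoffman =
  slim :: "'a set"
  fat :: "'a set"
  edges :: "('a \<times> 'a) set"

definition verts :: "'a hoffman \<Rightarrow> 'a set" where
  "verts h = slim h \<union> fat h"

abbreviation adj :: "'a hoffman \<Rightarrow> 'a \<Rightarrow> 'a \<Rightarrow> bool" where
  "adj h x y \<equiv> (x, y) \<in> edges h"

definition hoffman_graph :: "'a hoffman \<Rightarrow> bool" where
  "hoffman_graph h \<longleftrightarrow>
     finite (verts h) \<and> slim h \<inter> fat h = {} \<and>
     edges h \<subseteq> verts h \<times> verts h \<and> sym (edges h) \<and> irrefl (edges h) \<and>
     (\<forall>x \<in> fat h. \<exists>y \<in> slim h. adj h x y) \<and>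
     (\<forall>x \<in> fat h. \<forall>y \<in> fat h. \<not> adj h x y)"

definition fat_nbrs :: "'a hoffman \<Rightarrow> 'a \<Rightarrow> 'a set" where
  "fat_nbrs h x = {y \<in> fat h. adj h x y}"

definition hoffman_subgraph :: "'a hoffman \<Rightarrow> 'a hoffman \<Rightarrow> bool" where
  "hoffman_subgraph g h \<longleftrightarrow>
     hoffman_graph g \<and> hoffman_graph h \<and> slim g \<subseteq> slim h \<and> fat g \<subseteq> fat h \<and>
     edges g = edges h \<inter> (verts g \<times> verts g)"

definition slim_graph :: "'a hoffman \<Rightarrow> bool" where
  "slim_graph g \<longleftrightarrow> hoffman_graph g \<and> fat g = {}"

definition connected_graph :: "'a hoffman \<Rightarrow> bool" where
  "connected_graph g \<longleftrightarrow> (\<forall>x \<in> verts g. \<forall>y \<in> verts g. (x, y) \<in> (edges g)\<^sup>*)"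

definition fat_hoffman_graph :: "'a hoffman \<Rightarrow> bool" where
  "fat_hoffman_graph h \<longleftrightarrow> hoffman_graph h \<and> (\<forall>x \<in> slim h. fat_nbrs h x \<noteq> {})"

definition hoffman_iso :: "('a \<Rightarrow> 'b) \<Rightarrow> 'a hoffman \<Rightarrow> 'b hoffman \<Rightarrow> bool" where
  "hoffman_iso \<phi> h h' \<longleftrightarrow>
     bij_betw \<phi> (verts h) (verts h') \<and> \<phi> ` slim h = slim h' \<and> \<phi> ` fat h = fat h' \<and>
     (\<forall>x \<in> verts h. \<forall>y \<in> verts h. adj h x y \<longleftrightarrow> adj h' (\<phi> x) (\<phi> y))"

definition isomorphic :: "'a hoffman \<Rightarrow> 'b hoffman \<Rightarrow> bool" where
  "isomorphic h h' \<longleftrightarrow> hoffman_graph h \<and> hoffman_graph h' \<and> (\<exists>\<phi>. hoffman_iso \<phi> h h')"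

text \<open>Membership in a family, up to isomorphism.\<close>

definition in_family :: "'a hoffman \<Rightarrow> 'a hoffman set \<Rightarrow> bool" where
  "in_family h \<H> \<longleftrightarrow> (\<exists>h' \<in> \<H>. isomorphic h h')"

definition is_sum :: "'a hoffman \<Rightarrow> nat \<Rightarrow> (nat \<Rightarrow> 'a hoffman) \<Rightarrow> bool" where
  "is_sum h k hs \<longleftrightarrow>
     (\<forall>i<k. hoffman_subgraph (hs i) h) \<and>
     verts h = (\<Union>i<k. verts (hs i)) \<and>
     slim h = (\<Union>i<k. slim (hs i)) \<and>
     (\<forall>i<k. \<forall>j<k. i \<noteq> j \<longrightarrow> slim (hs i) \<inter> slim (hs j) = {}) \<and>
     (\<forall>i<k. \<forall>x \<in> slim (hs i). fat_nbrs (hs i) x = fat_nbrs h x) \<and>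
     (\<forall>i<k. \<forall>j<k. i \<noteq> j \<longrightarrow>
        (\<forall>x \<in> slim (hs i). \<forall>y \<in> slim (hs j).
           card (fat_nbrs h x \<inter> fat_nbrs h y) \<le> 1 \<and>
           (card (fat_nbrs h x \<inter> fat_nbrs h y) = 1 \<longleftrightarrow> adj h x y)))"

definition decomposable :: "'a hoffman \<Rightarrow> bool" where
  "decomposable h \<longleftrightarrow>
     hoffman_graph h \<and> (\<exists>hs. is_sum h 2 hs \<and> (\<forall>i<2. verts (hs i) \<noteq> {}))"

definition indecomposable :: "'a hoffman \<Rightarrow> bool" where
  "indecomposable h \<longleftrightarrow> hoffman_graph h \<and> \<not> decomposable h"

definition is_h2 :: "'a hoffman \<Rightarrow> bool" where
  "is_h2 h \<longleftrightarrow>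
     (\<exists>x a b. distinct [x, a, b] \<and>
        h = \<lparr>slim = {x}, fat = {a, b}, edges = {(x, a), (a, x), (x, b), (b, x)}\<rparr>)"

definition family_O :: "'a hoffman set" where
  "family_O =
     {h. is_h2 h} \<union>
     {h. indecomposable h \<and> fat_hoffman_graph h \<and> card (slim h) \<ge> 2 \<and> card (fat h) = 1}"

definition family_bar :: "'a hoffman set \<Rightarrow> 'a hoffman set" where
  "family_bar \<H> =
     {h. is_h2 h} \<union>
     {h \<in> family_O. \<exists>h' g. in_family h' \<H> \<and> hoffman_subgraph g h' \<and> isomorphic h g}"

definition cover :: "'a hoffman set \<Rightarrow> 'a hoffman \<Rightarrow> 'a hoffman \<Rightarrow> bool" where
  "cover \<H> g h \<longleftrightarrow>
     hoffman_subgraph g h \<and> (\<exists>k hs. is_sum h k hs \<and> (\<forall>i<k. in_family (hs i) \<H>))"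

definition strict_cover :: "'a hoffman set \<Rightarrow> 'a hoffman \<Rightarrow> 'a hoffman \<Rightarrow> bool" where
  "strict_cover \<H> g h \<longleftrightarrow> cover \<H> g h \<and> slim h = slim g"

definition line_hoffman_graph :: "'a hoffman set \<Rightarrow> 'a hoffman \<Rightarrow> bool" where
  "line_hoffman_graph \<H> g \<longleftrightarrow> (\<exists>h. cover \<H> g h)"

definition slim_line_graph :: "'a hoffman set \<Rightarrow> 'a hoffman \<Rightarrow> bool" where
  "slim_line_graph \<H> g \<longleftrightarrow> line_hoffman_graph \<H> g \<and> slim_graph g"

definition equivalent_covers :: "'a hoffman \<Rightarrow> 'a hoffman \<Rightarrow> 'a hoffman \<Rightarrow> bool" where
  "equivalent_covers g h h' \<longleftrightarrow> (\<exists>\<phi>. hoffman_iso \<phi> h h' \<and> (\<forall>x \<in> verts g. \<phi> x = x))"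

definition unique_strict_cover :: "'a hoffman set \<Rightarrow> 'a hoffman \<Rightarrow> bool" where
  "unique_strict_cover \<H> g \<longleftrightarrow>
     (\<exists>h. strict_cover \<H> g h) \<and>
     (\<forall>h h'. strict_cover \<H> g h \<longrightarrow> strict_cover \<H> g h' \<longrightarrow> equivalent_covers g h h')"

end

theory Submission
  imports Defs
begin

text \<open>A strict cover of a connected slim graph \<open>g\<close> is determined by which triples of vertices of \<open>g\<close>
  have a common fat neighbour, since the fat neighbour of two distinct vertices is unique and a fat
  vertex with only one slim neighbour \<open>x\<close> is present exactly when \<open>x\<close> lies in one other fat
  neighbourhood and is adjacent to all of it. Deleting a non-cut vertex of \<open>g\<close> turns a strict cover
  into a strict cover of the smaller graph with the same triples. A connected graph has two non-cut
  vertices \<open>a\<close> and \<open>b\<close>, so by induction on the order two covers of \<open>g\<close> can only disagree on triples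
  containing both; such a disagreement forces \<open>g\<close> to consist of \<open>a\<close>, \<open>b\<close> and one more vertex.\<close>

section \<open>Connected vertex sets\<close>

text \<open>Deleting a vertex of \<open>g\<close> from a cover need not leave a sum of members of
  \<open>family_O\<close>: a piece may fall apart, or shrink to one slim vertex with one fat
  neighbour. The proof therefore forgets the pieces and keeps only the map \<open>F\<close> from
  slim vertices to their sets of fat neighbours. The pieces can be recovered: a vertex with two fat
  neighbours is a copy of \<open>h_2\<close> by itself, and the other pieces are the components of
  non-adjacency among vertices with the same single fat neighbour. Components of a shrunken piece
  stay admissible because \<open>family_bar\<close> contains the indecomposable fat subgraphs of
  members. A component of one vertex is repaired by a private fat vertex, taken from the infinite
  type; it is shared by nobody, so no triple changes. Triples suffice because a fat vertex with two
  slim neighbours is pinned down by any two of them, and a third argument then tests membership in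
  its neighbourhood.\<close>

definition connected_on :: "('a \<times> 'a) set \<Rightarrow> 'a set \<Rightarrow> bool" where
  "connected_on E V \<longleftrightarrow> (\<forall>x\<in>V. \<forall>y\<in>V. (x, y) \<in> (E \<inter> V \<times> V)\<^sup>*)"

lemma connected_on_subset_closed:
  assumes "connected_on E V" "x \<in> C" "x \<in> V"
    and "\<And>u v. u \<in> C \<Longrightarrow> u \<in> V \<Longrightarrow> v \<in> V \<Longrightarrow> (u, v) \<in> E \<Longrightarrow> v \<in> C"
  shows "V \<subseteq> C"
proof
  fix y assume "y \<in> V"
  then have "(x, y) \<in> (E \<inter> V \<times> V)\<^sup>*" using assms unfolding connected_on_def by blast
  then show "y \<in> C"
    by (induction rule: rtrancl_induct) (use assms in auto)
qed

lemma connected_on_edge_out: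
  assumes "connected_on E V" "C \<subset> V" "C \<noteq> {}"
  obtains u v where "u \<in> C" "v \<in> V - C" "(u, v) \<in> E"
proof -
  obtain x where x: "x \<in> C" "x \<in> V" using assms by blast
  show ?thesis
    using connected_on_subset_closed[OF assms(1) x] assms(2) that by blast
qed

lemma connected_on_insert:
  assumes "sym E" "connected_on E C" "u \<in> C" "(u, v) \<in> E"
  shows "connected_on E (insert v C)"
proof -
  let ?R = "E \<inter> insert v C \<times> insert v C"
  have sub: "(E \<inter> C \<times> C)\<^sup>* \<subseteq> ?R\<^sup>*" by (rule rtrancl_mono) auto
  have "(x, u) \<in> ?R\<^sup>* \<and> (u, x) \<in> ?R\<^sup>*" if "x \<in> insert v C" for x
  proof (cases "x \<in> C")
    case True
    then show ?thesis using assms(2,3) sub unfolding connected_on_def by blast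
  next
    case False
    then have "(u, x) \<in> ?R" "(x, u) \<in> ?R" using that assms by (auto dest: symD)
    then show ?thesis by auto
  qed
  then show ?thesis unfolding connected_on_def by (meson rtrancl_trans)
qed

text \<open>A maximal proper connected subset containing \<open>r\<close> misses exactly one vertex.\<close>

lemma ex_non_cut_vertex:
  assumes "finite V" "sym E" "connected_on E V" "r \<in> V" "V \<noteq> {r}"
  obtains v where "v \<in> V" "v \<noteq> r" "connected_on E (V - {v})"
proof -
  let ?P = "\<lambda>C. r \<in> C \<and> C \<subset> V \<and> connected_on E C"
  have "?P {r}" using assms(4,5) by (auto simp: connected_on_def)
  moreover have "\<forall>C. ?P C \<longrightarrow> card C < Suc (card V)"
    using assms(1) by (auto simp: less_Suc_eq dest: psubset_card_mono)
  ultimately obtain C where C: "?P C" and max: "\<And>D. ?P D \<Longrightarrow> card D \<le> card C"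
    using ex_has_greatest_nat[of ?P "{r}" card "Suc (card V)"] by (metis less_imp_le)
  obtain u v where uv: "u \<in> C" "v \<in> V - C" "(u, v) \<in> E"
    using connected_on_edge_out[OF assms(3)] C by blast
  have "finite C" using C assms(1) finite_subset by blast
  then have "card (insert v C) > card C" using uv by simp
  moreover have "connected_on E (insert v C)"
    using connected_on_insert[OF assms(2) _ uv(1,3)] C by blast
  ultimately have "\<not> insert v C \<subset> V" using max[of "insert v C"] C by auto
  then have "C = V - {v}" using C uv by blast
  then show ?thesis using that[of v] C uv by blast
qed

text \<open>A walk can enter and leave \<open>c\<close> only through \<open>a\<close> or
  \<open>b\<close>, so each visit to \<open>c\<close> can be replaced by staying put or by crossing
  the edge between \<open>a\<close> and \<open>b\<close>.\<close>

lemma connected_on_remove: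
  assumes conn: "connected_on E V" and "sym E"
    and ab: "a \<in> V" "b \<in> V" "a \<noteq> c" "b \<noteq> c" "(a, b) \<in> E"
    and nb: "\<And>u. u \<in> V \<Longrightarrow> (c, u) \<in> E \<Longrightarrow> u = a \<or> u = b"
  shows "connected_on E (V - {c})"
proof -
  let ?R = "E \<inter> (V - {c}) \<times> (V - {c})"
  have abR: "(a, b) \<in> ?R" "(b, a) \<in> ?R" using ab \<open>sym E\<close> by (auto dest: symD)
  \<comment> \<open>While the walk sits at \<open>c\<close>, the invariant records that both
    possible exits are already reachable without \<open>c\<close>.\<close>
  have "(y \<noteq> c \<longrightarrow> (x, y) \<in> ?R\<^sup>*) \<and> (y = c \<longrightarrow> (x, a) \<in> ?R\<^sup>* \<and> (x, b) \<in> ?R\<^sup>*)"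
    if "x \<in> V - {c}" "(x, y) \<in> (E \<inter> V \<times> V)\<^sup>*" for x y
    using that(2)
  proof (induction rule: rtrancl_induct)
    case base
    then show ?case using that by auto
  next
    case (step y z)
    have yz: "(y, z) \<in> E" "y \<in> V" "z \<in> V" using step by auto
    consider "y = c" "z \<noteq> c" | "y = c" "z = c" | "y \<noteq> c" "z = c" | "y \<noteq> c" "z \<noteq> c" by blast
    then show ?case
    proof cases
      case 1
      then show ?thesis using nb[of z] yz step.IH by auto
    next
      case 2
      then show ?thesis using step.IH by auto
    next
      case 3
      then have "(c, y) \<in> E" using yz \<open>sym E\<close> by (auto dest: symD)
      then have "y = a \<or> y = b" using nb yz by blast
      then show ?thesis using 3 step.IH abR by (meson rtrancl.rtrancl_into_rtrancl)
    next
      case 4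
      then have "(y, z) \<in> ?R" using yz by auto
      then show ?thesis using 4 step.IH by (meson rtrancl.rtrancl_into_rtrancl)
    qed
  qed
  then show ?thesis using conn unfolding connected_on_def by blast
qed

section \<open>Systems of fat neighbourhoods\<close>

text \<open>This is what a sum of members of \<open>family_O\<close> imposes on the sets of fat
  neighbours. Only \<open>h_2\<close> has two fat vertices, hence \<open>card_F_le\<close>.
  Non-adjacent vertices with a common fat neighbour must lie in one piece, and a piece with two slim
  vertices has a single fat vertex, hence \<open>nonadj_common\<close>.\<close>

locale fat_system =
  fixes V :: "'a set" and E :: "('a \<times> 'a) set" and F :: "'a \<Rightarrow> 'a set"
  assumes finite_F: "x \<in> V \<Longrightarrow> finite (F x)"
    and F_nonempty: "x \<in> V \<Longrightarrow> F x \<noteq> {}"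
    and card_F_le: "x \<in> V \<Longrightarrow> card (F x) \<le> 2"
    and common_unique: "x \<in> V \<Longrightarrow> y \<in> V \<Longrightarrow> x \<noteq> y \<Longrightarrow>
      f \<in> F x \<Longrightarrow> f \<in> F y \<Longrightarrow> f' \<in> F x \<Longrightarrow> f' \<in> F y \<Longrightarrow> f = f'"
    and adj_common: "x \<in> V \<Longrightarrow> y \<in> V \<Longrightarrow> (x, y) \<in> E \<Longrightarrow> \<exists>f. f \<in> F x \<and> f \<in> F y"
    and nonadj_common: "x \<in> V \<Longrightarrow> y \<in> V \<Longrightarrow> x \<noteq> y \<Longrightarrow> (x, y) \<notin> E \<Longrightarrow>
      f \<in> F x \<Longrightarrow> f \<in> F y \<Longrightarrow> F x = {f}"
begin

lemma F_two:
  assumes "x \<in> V" "f \<in> F x" "f' \<in> F x" "f \<noteq> f'"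
  shows "F x = {f, f'}"
proof -
  have "{f, f'} \<subseteq> F x" "card {f, f'} = 2" using assms by auto
  then show ?thesis using card_F_le finite_F assms by (metis card_seteq)
qed

end

section \<open>Comparing two systems through triples\<close>

definition joined :: "('a \<Rightarrow> 'a set) \<Rightarrow> 'a \<Rightarrow> 'a \<Rightarrow> 'a \<Rightarrow> bool" where
  "joined F x y z \<longleftrightarrow> (\<exists>f. f \<in> F x \<and> f \<in> F y \<and> f \<in> F z)"

text \<open>The third argument may repeat one of the first two, so pairs are compared as well:
  \<open>joined F x y y\<close> says that \<open>x\<close> and \<open>y\<close> have a common fat
  neighbour. Distinct \<open>x\<close> and \<open>y\<close> make that neighbour unique.\<close>

definition agree_on :: "'a set \<Rightarrow> ('a \<Rightarrow> 'a set) \<Rightarrow> ('a \<Rightarrow> 'a set) \<Rightarrow> bool" where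
  "agree_on V F G \<longleftrightarrow>
     (\<forall>x\<in>V. \<forall>y\<in>V. \<forall>z\<in>V. x \<noteq> y \<longrightarrow> joined F x y z = joined G x y z)"

lemma agree_on_sym: "agree_on V F G \<Longrightarrow> agree_on V G F"
  unfolding agree_on_def by auto

lemma joinedI: "f \<in> F x \<Longrightarrow> f \<in> F y \<Longrightarrow> f \<in> F z \<Longrightarrow> joined F x y z"
  unfolding joined_def by auto

text \<open>Agreement is assumed after deleting any non-cut vertex, not just \<open>a\<close> or
  \<open>b\<close>: the transfer of a triple also deletes its third vertex.\<close>

locale two_systems = S: fat_system V E F + T: fat_system V E G
  for V :: "'a set" and E F G +
  fixes a b
  assumes sym: "sym E" and irr: "irrefl E" and conn: "connected_on E V"
    and ge4: "card V \<ge> 4"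
    and a: "a \<in> V" and b: "b \<in> V" and ab: "a \<noteq> b"
    and agree_del: "\<And>v. v \<in> V \<Longrightarrow> connected_on E (V - {v}) \<Longrightarrow> agree_on (V - {v}) F G"
    and non_cut_a: "connected_on E (V - {a})" and non_cut_b: "connected_on E (V - {b})"
begin

lemma symE: "(x, y) \<in> E \<Longrightarrow> (y, x) \<in> E"
  using sym by (auto dest: symD)

lemma agree_a:
  "x \<in> V \<Longrightarrow> y \<in> V \<Longrightarrow> z \<in> V \<Longrightarrow> x \<noteq> y \<Longrightarrow> a \<notin> {x, y, z} \<Longrightarrow> joined F x y z = joined G x y z"
  using agree_del[OF a non_cut_a] unfolding agree_on_def by auto

lemma agree_b:
  "x \<in> V \<Longrightarrow> y \<in> V \<Longrightarrow> z \<in> V \<Longrightarrow> x \<noteq> y \<Longrightarrow> b \<notin> {x, y, z} \<Longrightarrow> joined F x y z = joined G x y z"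
  using agree_del[OF b non_cut_b] unfolding agree_on_def by auto

text \<open>By connectedness a set containing \<open>a\<close> and closed under adjacency is all of
  \<open>V\<close>, but three vertices are too few. Both transfer arguments end in this
  contradiction.\<close>

lemma not_closed_triple:
  assumes "\<And>u v. u \<in> {a, b, c} \<Longrightarrow> v \<in> V \<Longrightarrow> (u, v) \<in> E \<Longrightarrow> v \<in> {a, b, c}"
  shows False
proof -
  have "V \<subseteq> {a, b, c}"
    using connected_on_subset_closed[OF conn, of a "{a, b, c}"] a assms by blast
  then have "card V \<le> card {a, b, c}" by (intro card_mono) auto
  also have "\<dots> \<le> 3" by (auto simp: card_insert_if)
  finally show False using ge4 by simp
qed

text \<open>If \<open>G\<close> separates \<open>a\<close> from \<open>b\<close>, they are
  non-adjacent and \<open>f\<close> is the only element of \<open>F a\<close> and of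
  \<open>F b\<close>. A neighbour \<open>w\<close> of \<open>a\<close> then also has
  \<open>f\<close>, and the pairs \<open>a\<close>, \<open>w\<close> and \<open>b\<close>,
  \<open>w\<close> transfer to distinct \<open>f1\<close> and \<open>f2\<close>, which exhaust
  \<open>G w\<close>. A further vertex at \<open>f\<close> would share both with \<open>w\<close>,
  so \<open>f\<close> sees only \<open>a\<close>, \<open>b\<close>, \<open>w\<close>. A neighbour of
  \<open>w\<close> meets it in \<open>f1\<close> or \<open>f2\<close>, and that triple transfers
  back to \<open>f\<close>; hence \<open>{a, b, w}\<close> is closed under adjacency.\<close>

lemma pair_transfer:
  assumes f: "f \<in> F a" "f \<in> F b"
  shows "\<exists>f'. f' \<in> G a \<and> f' \<in> G b"
proof (rule ccontr)
  assume no: "\<nexists>f'. f' \<in> G a \<and> f' \<in> G b"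
  then have nadj: "(a, b) \<notin> E" using T.adj_common a b by blast
  have Fa: "F a = {f}" using S.nonadj_common[OF a b ab nadj f] .
  have Fb: "F b = {f}"
    using S.nonadj_common[OF b a ab[symmetric] _ f(2,1)] nadj symE by blast
  have "{a} \<subset> V" using a b ab by blast
  then obtain w where w: "w \<in> V - {a}" "(a, w) \<in> E"
    by (rule connected_on_edge_out[OF conn]) auto
  have wV: "w \<in> V" "w \<noteq> a" "w \<noteq> b" using w nadj by auto
  have fw: "f \<in> F w" using S.adj_common[OF a wV(1) w(2)] Fa by auto
  have "joined G a w w" using agree_b[OF a wV(1) wV(1)] joinedI[of f F] f fw wV ab by auto
  then obtain f1 where f1: "f1 \<in> G a" "f1 \<in> G w" unfolding joined_def by blast
  have "joined G b w w" using agree_a[OF b wV(1) wV(1)] joinedI[of f F] f fw wV ab by auto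
  then obtain f2 where f2: "f2 \<in> G b" "f2 \<in> G w" unfolding joined_def by blast
  have "f1 \<noteq> f2" using no f1 f2 by auto
  then have Gw: "G w = {f1, f2}" using T.F_two wV f1 f2 by blast
  have Sf: "v \<in> {a, b, w}" if v: "v \<in> V" "f \<in> F v" for v
  proof (rule ccontr)
    assume nv: "v \<notin> {a, b, w}"
    have "joined G a w v" using agree_b[OF a wV(1) v(1)] joinedI[of f F] f fw wV v nv ab by auto
    then have "f1 \<in> G v" using T.common_unique[OF a wV(1)] wV f1 unfolding joined_def by blast
    moreover have "joined G b w v"
      using agree_a[OF b wV(1) v(1)] joinedI[of f F] f fw wV v nv ab by auto
    then have "f2 \<in> G v" using T.common_unique[OF b wV(1)] wV f2 unfolding joined_def by blast
    ultimately show False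
      using T.common_unique[OF wV(1) v(1)] nv f1 f2 \<open>f1 \<noteq> f2\<close> by blast
  qed
  have "v \<in> {a, b, w}" if uv: "u \<in> {a, b, w}" "v \<in> V" "(u, v) \<in> E" for u v
  proof -
    consider "u = a" | "u = b" | "u = w" using uv by blast
    then show ?thesis
    proof cases
      case 1
      then show ?thesis using S.adj_common[OF a uv(2)] uv Fa Sf by auto
    next
      case 2
      then show ?thesis using S.adj_common[OF b uv(2)] uv Fb Sf by auto
    next
      case 3
      show ?thesis
      proof (rule ccontr)
        assume nv: "v \<notin> {a, b, w}"
        consider "f1 \<in> G v" | "f2 \<in> G v" using T.adj_common[OF wV(1) uv(2)] uv 3 Gw by auto
        then show False
        proof cases
          case 1
          then have "joined F a w v"
            using agree_b[OF a wV(1) uv(2)] joinedI[of f1 G] f1 wV nv ab by auto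
          then show False using Fa Sf uv nv unfolding joined_def by auto
        next
          case 2
          then have "joined F b w v"
            using agree_a[OF b wV(1) uv(2)] joinedI[of f2 G] f2 wV nv ab by auto
          then show False using Fb Sf uv nv unfolding joined_def by auto
        qed
      qed
    qed
  qed
  then show False using not_closed_triple by blast
qed

text \<open>If the triple is lost in \<open>G\<close>, its three pairs meet in three different fat
  vertices \<open>f1\<close>, \<open>f2\<close>, \<open>f3\<close>, which exhaust
  \<open>G a\<close>, \<open>G b\<close> and \<open>G c\<close>. No outside vertex has
  \<open>f2\<close> or \<open>f3\<close>, since such a triple omits \<open>a\<close> or
  \<open>b\<close> and transfers back to \<open>f\<close>, where \<open>Sf\<close> forbids it. It
  remains to exclude outside vertices at \<open>f1\<close>, whose triples contain both
  \<open>a\<close> and \<open>b\<close>.\<close>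

lemma triple_transfer:
  assumes c: "c \<in> V" "c \<noteq> a" "c \<noteq> b" and f: "f \<in> F a" "f \<in> F b" "f \<in> F c"
  shows "joined G a b c"
proof (rule ccontr)
  assume no: "\<not> joined G a b c"
  obtain f1 where f1: "f1 \<in> G a" "f1 \<in> G b" using pair_transfer f by blast
  have "joined G b c c" using agree_a[OF b c(1) c(1)] joinedI[of f F] f c ab by auto
  then obtain f2 where f2: "f2 \<in> G b" "f2 \<in> G c" unfolding joined_def by blast
  have "joined G a c c" using agree_b[OF a c(1) c(1)] joinedI[of f F] f c ab by auto
  then obtain f3 where f3: "f3 \<in> G a" "f3 \<in> G c" unfolding joined_def by blast
  have ne: "f1 \<noteq> f2" "f1 \<noteq> f3" "f2 \<noteq> f3" using no f1 f2 f3 unfolding joined_def by auto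
  have Ga: "G a = {f1, f3}" using T.F_two[OF a] f1 f3 ne by blast
  have Gb: "G b = {f1, f2}" using T.F_two[OF b] f1 f2 ne by blast
  have Gc: "G c = {f2, f3}" using T.F_two[OF c(1)] f2 f3 ne by blast
  have Sf: "v \<in> {a, b, c}" if v: "v \<in> V" "f \<in> F v" for v
  proof (rule ccontr)
    assume nv: "v \<notin> {a, b, c}"
    have "joined G a c v" using agree_b[OF a c(1) v(1)] joinedI[of f F] f c v nv ab by auto
    then have "f3 \<in> G v" using Ga Gc ne unfolding joined_def by auto
    moreover have "joined G b c v"
      using agree_a[OF b c(1) v(1)] joinedI[of f F] f c v nv ab by auto
    then have "f2 \<in> G v" using Gb Gc ne unfolding joined_def by auto
    ultimately show False using T.common_unique[OF c(1) v(1)] nv f2 f3 ne by blast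
  qed
  have no3: "f3 \<notin> G v" if "v \<in> V" "v \<notin> {a, b, c}" for v
  proof
    assume "f3 \<in> G v"
    then have "joined F a c v"
      using agree_b[OF a c(1) that(1)] joinedI[of f3 G] f3 c that ab by auto
    then show False using S.common_unique[OF a c(1)] c f Sf that unfolding joined_def by blast
  qed
  have no2: "f2 \<notin> G v" if "v \<in> V" "v \<notin> {a, b, c}" for v
  proof
    assume "f2 \<in> G v"
    then have "joined F b c v"
      using agree_a[OF b c(1) that(1)] joinedI[of f2 G] f2 c that ab by auto
    then show False using S.common_unique[OF b c(1)] c f Sf that unfolding joined_def by blast
  qed
  have nbc: "u = a \<or> u = b" if "u \<in> V" "(c, u) \<in> E" for u
  proof -
    have "u \<noteq> c" using that irr unfolding irrefl_def by blast
    then show ?thesis using T.adj_common[OF c(1) that(1,2)] Gc no2 no3 that by auto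
  qed
  \<comment> \<open>Non-adjacent vertices with a common fat neighbour have no other one, whereas
    \<open>G a\<close> has two elements.\<close>
  have adj: "(a, b) \<in> E"
    using T.nonadj_common[OF a b ab _ f1] Ga ne by auto
  \<comment> \<open>The only neighbours of \<open>c\<close> are the adjacent vertices
    \<open>a\<close> and \<open>b\<close>, so \<open>c\<close> is not a cut vertex either. Deleting
    it compares the triples that contain both \<open>a\<close> and \<open>b\<close>.\<close>
  have "connected_on E (V - {c})"
    using connected_on_remove[OF conn sym a b _ _ adj nbc] c by auto
  from agree_del[OF c(1) this]
  have agree_c: "joined F a b z = joined G a b z" if "z \<in> V" "z \<noteq> c" for z
    using a b ab c that unfolding agree_on_def by auto
  have no1: "f1 \<notin> G v" if "v \<in> V" "v \<notin> {a, b, c}" for v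
  proof
    assume "f1 \<in> G v"
    then have "joined F a b v" using agree_c[of v] joinedI[of f1 G] f1 that by auto
    then show False using S.common_unique[OF a b ab] f Sf that unfolding joined_def by blast
  qed
  have "v \<in> {a, b, c}" if uv: "u \<in> {a, b, c}" "v \<in> V" "(u, v) \<in> E" for u v
  proof (rule ccontr)
    assume nv: "v \<notin> {a, b, c}"
    obtain f' where "f' \<in> G u" "f' \<in> G v" using T.adj_common[of u v] uv a b c by blast
    then show False using uv nv no1 no2 no3 Ga Gb Gc by auto
  qed
  then show False using not_closed_triple by blast
qed

lemma joined_transfer:
  assumes xyz: "x \<in> V" "y \<in> V" "z \<in> V" "x \<noteq> y" and F: "joined F x y z"
  shows "joined G x y z"
proof (cases "a \<in> {x, y, z} \<and> b \<in> {x, y, z}")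
  case False
  then show ?thesis using agree_a[OF xyz] agree_b[OF xyz] F by blast
next
  case True
  obtain f where f: "f \<in> F x" "f \<in> F y" "f \<in> F z" using F unfolding joined_def by blast
  show ?thesis
  \<comment> \<open>In this case an argument is repeated and only the pair has to be
    transferred.\<close>
  proof (cases "{x, y, z} = {a, b}")
    case True
    then have "f \<in> F a" "f \<in> F b" using f by auto
    then obtain f' where "f' \<in> G a" "f' \<in> G b" using pair_transfer by blast
    then show ?thesis using True by (intro joinedI[of f']) auto
  next
    case False
    then obtain c where c: "{x, y, z} = {a, b, c}" "c \<noteq> a" "c \<noteq> b" "c \<in> V"
      using True xyz ab by auto
    have "f \<in> F a" "f \<in> F b" "f \<in> F c" using c(1) f by auto
    then have "joined G a b c" using triple_transfer c by blast
    then obtain f' where "f' \<in> G a" "f' \<in> G b" "f' \<in> G c" unfolding joined_def by blast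
    then show ?thesis using c(1) by (intro joinedI[of f']) auto
  qed
qed

end

lemma agree_on_if_agree_on_deletions:
  assumes "fat_system V E F" "fat_system V E G" "sym E" "irrefl E" "connected_on E V" "card V \<ge> 4"
    and del: "\<And>v. v \<in> V \<Longrightarrow> connected_on E (V - {v}) \<Longrightarrow> agree_on (V - {v}) F G"
  shows "agree_on V F G"
proof -
  have fin: "finite V" using assms(6) card.infinite by fastforce
  have ne: "V \<noteq> {r}" for r using assms(6) by auto
  obtain r where "r \<in> V" using assms(6) by fastforce
  \<comment> \<open>A non-cut vertex can be found away from any prescribed vertex; avoiding first an
    arbitrary \<open>r\<close> and then \<open>a\<close> gives two distinct ones.\<close>
  then obtain a where a: "a \<in> V" "connected_on E (V - {a})"
    using ex_non_cut_vertex[OF fin assms(3,5) _ ne] by metis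
  then obtain b where b: "b \<in> V" "b \<noteq> a" "connected_on E (V - {b})"
    using ex_non_cut_vertex[OF fin assms(3,5) _ ne] by metis
  have FG: "two_systems V E F G a b"
    using assms a b by (intro two_systems.intro two_systems_axioms.intro) auto
  have GF: "two_systems V E G F a b"
    using assms a b by (intro two_systems.intro two_systems_axioms.intro agree_on_sym[OF del]) auto
  show ?thesis
    unfolding agree_on_def
    using two_systems.joined_transfer[OF FG] two_systems.joined_transfer[OF GF] by blast
qed


section \<open>Pieces of a sum\<close>

definition induced :: "'a hoffman \<Rightarrow> 'a set \<Rightarrow> 'a set \<Rightarrow> 'a hoffman" where
  "induced h C D = \<lparr>slim = C, fat = D, edges = edges h \<inter> (C \<union> D) \<times> (C \<union> D)\<rparr>"

lemma induced_simps [simp]: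
  "slim (induced h C D) = C" "fat (induced h C D) = D" "verts (induced h C D) = C \<union> D"
  "edges (induced h C D) = edges h \<inter> (C \<union> D) \<times> (C \<union> D)"
  by (auto simp: induced_def verts_def)

lemma hoffman_subgraph_induced:
  assumes "hoffman_graph h" "C \<subseteq> slim h" "D \<subseteq> fat h" "\<And>f. f \<in> D \<Longrightarrow> \<exists>x\<in>C. adj h f x"
  shows "hoffman_subgraph (induced h C D) h"
proof -
  have "hoffman_graph (induced h C D)"
    using assms finite_subset[of "C \<union> D" "verts h"]
    unfolding hoffman_graph_def
    by (auto simp: verts_def sym_def irrefl_def) (meson IntI disjoint_iff subset_iff)+
  then show ?thesis using assms unfolding hoffman_subgraph_def by auto
qed

lemma fat_nbrs_induced:
  "D \<subseteq> fat h \<Longrightarrow> x \<in> C \<Longrightarrow> fat_nbrs (induced h C D) x = fat_nbrs h x \<inter> D"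
  by (auto simp: fat_nbrs_def)

lemma is_sumD:
  assumes "is_sum h k hs"
  shows "i < k \<Longrightarrow> hoffman_subgraph (hs i) h"
    and "slim h = (\<Union>i<k. slim (hs i))"
    and "i < k \<Longrightarrow> j < k \<Longrightarrow> i \<noteq> j \<Longrightarrow> slim (hs i) \<inter> slim (hs j) = {}"
    and "i < k \<Longrightarrow> x \<in> slim (hs i) \<Longrightarrow> fat_nbrs (hs i) x = fat_nbrs h x"
    and "i < k \<Longrightarrow> j < k \<Longrightarrow> i \<noteq> j \<Longrightarrow> x \<in> slim (hs i) \<Longrightarrow> y \<in> slim (hs j) \<Longrightarrow>
      card (fat_nbrs h x \<inter> fat_nbrs h y) \<le> 1"
    and "i < k \<Longrightarrow> j < k \<Longrightarrow> i \<noteq> j \<Longrightarrow> x \<in> slim (hs i) \<Longrightarrow> y \<in> slim (hs j) \<Longrightarrow>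
      card (fat_nbrs h x \<inter> fat_nbrs h y) = 1 \<longleftrightarrow> adj h x y"
  using assms unfolding is_sum_def by simp_all

section \<open>The shape of members of the family\<close>

lemma is_h2_hoffman_graph: "is_h2 h \<Longrightarrow> hoffman_graph h"
  by (auto simp: is_h2_def hoffman_graph_def verts_def sym_def irrefl_def)

lemma family_O_hoffman_graph: "h \<in> family_O \<Longrightarrow> hoffman_graph h"
  unfolding family_O_def by (auto simp: is_h2_hoffman_graph indecomposable_def)

text \<open>A first-order consequence of membership in \<open>family_O\<close> that is easy to move
  along isomorphisms. Indecomposability is weakened to: no slim vertex is adjacent to all other slim
  ones.\<close>

definition O_shape :: "'a hoffman \<Rightarrow> bool" where
  "O_shape h \<longleftrightarrow> hoffman_graph h \<and> (\<forall>x\<in>slim h. \<forall>f\<in>fat h. adj h x f) \<and>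
     (card (slim h) = 1 \<and> card (fat h) = 2 \<or>
      card (fat h) = 1 \<and> (\<forall>x\<in>slim h. \<exists>y\<in>slim h. y \<noteq> x \<and> \<not> adj h x y))"

text \<open>With one fat vertex \<open>f\<close>, a slim vertex \<open>x\<close> adjacent to all
  other slim vertices could be split off: \<open>x\<close> with \<open>f\<close> and the rest with
  \<open>f\<close> form a sum, because every pair across is adjacent and has exactly
  \<open>f\<close> in common.\<close>

lemma family_O_shape:
  assumes "h \<in> family_O"
  shows "O_shape h"
proof (cases "is_h2 h")
  case True
  then show ?thesis
    using is_h2_hoffman_graph[OF True] unfolding O_shape_def is_h2_def by auto
next
  case False
  then have h: "hoffman_graph h" "\<not> decomposable h" "fat_hoffman_graph h"
    "card (slim h) \<ge> 2" "card (fat h) = 1"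
    using assms unfolding family_O_def indecomposable_def by auto
  obtain f where f: "fat h = {f}" using h(5) card_1_singletonE by blast
  have F: "fat_nbrs h x = {f}" if "x \<in> slim h" for x
    using h(3) that f unfolding fat_hoffman_graph_def fat_nbrs_def by fastforce
  then have xf: "adj h x f" if "x \<in> slim h" for x
    using that unfolding fat_nbrs_def by blast
  then have fx: "adj h f x" if "x \<in> slim h" for x
    using that h(1) unfolding hoffman_graph_def by (auto dest: symD)
  have "\<exists>y\<in>slim h. y \<noteq> x \<and> \<not> adj h x y" if x: "x \<in> slim h" for x
  proof (rule ccontr)
    assume all: "\<not> ?thesis"
    then have adj: "adj h x y" "adj h y x" if "y \<in> slim h - {x}" for y
      using that h(1) unfolding hoffman_graph_def by (auto dest: symD)
    have "slim h \<noteq> {x}" using h(4) by auto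
    then obtain z where z: "z \<in> slim h" "z \<noteq> x" using x by blast
    define hs where "hs i = induced h (if i = (0::nat) then {x} else slim h - {x}) {f}" for i
    have two: "i = 0 \<or> i = 1" if "i < 2" for i :: nat using that by auto
    have U: "(\<Union>i<2::nat. A i) = A 0 \<union> A 1" for A :: "nat \<Rightarrow> 'a set"
      by (auto simp: numeral_2_eq_2 less_Suc_eq)
    have "is_sum h 2 hs"
      unfolding is_sum_def
    proof (intro conjI allI impI ballI)
      fix i :: nat assume "i < 2"
      then show "hoffman_subgraph (hs i) h"
        unfolding hs_def using x fx f z h(1)
        by (intro hoffman_subgraph_induced) auto
    next
      show "verts h = (\<Union>i<2. verts (hs i))" "slim h = (\<Union>i<2. slim (hs i))"
        unfolding U hs_def verts_def using x f by auto
    next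
      fix i j :: nat assume "i < 2" "j < 2" "i \<noteq> j"
      then show "slim (hs i) \<inter> slim (hs j) = {}"
        by (auto simp: hs_def)
    next
      fix i :: nat and y assume "i < 2" "y \<in> slim (hs i)"
      then show "fat_nbrs (hs i) y = fat_nbrs h y"
        unfolding hs_def using x F f by (auto simp: fat_nbrs_induced split: if_splits)
    next
      fix i j :: nat and u v assume ij: "i < 2" "j < 2" "i \<noteq> j"
        and uv: "u \<in> slim (hs i)" "v \<in> slim (hs j)"
      have "u \<in> slim h" "v \<in> slim h" "adj h u v"
        using ij uv x adj two[of i] two[of j] by (auto simp: hs_def)
      then show "card (fat_nbrs h u \<inter> fat_nbrs h v) \<le> 1"
        "(card (fat_nbrs h u \<inter> fat_nbrs h v) = 1) = adj h u v"
        by (auto simp: F)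
    qed
    moreover have "\<forall>i<2. verts (hs i) \<noteq> {}" by (auto simp: hs_def)
    ultimately show False using h(1,2) unfolding decomposable_def by blast
  qed
  then show ?thesis using h xf f unfolding O_shape_def by auto
qed

lemma O_shape_isomorphic:
  assumes "isomorphic h h'" "O_shape h'"
  shows "O_shape h"
proof -
  obtain \<phi> where "hoffman_iso \<phi> h h'" "hoffman_graph h"
    using assms(1) unfolding isomorphic_def by blast
  then have p: "bij_betw \<phi> (verts h) (verts h')" "\<phi> ` slim h = slim h'" "\<phi> ` fat h = fat h'"
    and adj: "\<And>x y. x \<in> verts h \<Longrightarrow> y \<in> verts h \<Longrightarrow> adj h x y \<longleftrightarrow> adj h' (\<phi> x) (\<phi> y)"
    unfolding hoffman_iso_def by auto
  have inj: "inj_on \<phi> (slim h)" "inj_on \<phi> (fat h)"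
    using p(1) unfolding bij_betw_def verts_def by (auto intro: inj_on_subset)
  have "card (slim h) = card (slim h')" "card (fat h) = card (fat h')"
    using card_image[OF inj(1)] card_image[OF inj(2)] p by auto
  moreover have "adj h x f" if "x \<in> slim h" "f \<in> fat h" for x f
    using adj[of x f] that p assms(2) unfolding O_shape_def verts_def by blast
  moreover have "\<exists>y\<in>slim h. y \<noteq> x \<and> \<not> adj h x y"
    if all: "\<forall>x\<in>slim h'. \<exists>y\<in>slim h'. y \<noteq> x \<and> \<not> adj h' x y" and x: "x \<in> slim h" for x
  proof -
    have "\<phi> x \<in> slim h'" using x p(2) by auto
    then obtain y' where y': "y' \<in> slim h'" "y' \<noteq> \<phi> x" "\<not> adj h' (\<phi> x) y'"
      using all by auto
    then obtain y where y: "y \<in> slim h" "y' = \<phi> y" using p(2) by auto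
    then have "\<not> adj h x y" using y' adj[of x y] x unfolding verts_def by auto
    then show ?thesis using y y' by auto
  qed
  ultimately show ?thesis using assms(2) \<open>hoffman_graph h\<close> unfolding O_shape_def by auto
qed

section \<open>Embeddings and subgraphs up to isomorphism\<close>

definition embeds :: "'a hoffman \<Rightarrow> 'a hoffman \<Rightarrow> bool" where
  "embeds h k \<longleftrightarrow> (\<exists>\<phi>. inj_on \<phi> (verts h) \<and> \<phi> ` slim h \<subseteq> slim k \<and> \<phi> ` fat h \<subseteq> fat k \<and>
     (\<forall>x\<in>verts h. \<forall>y\<in>verts h. adj h x y \<longleftrightarrow> adj k (\<phi> x) (\<phi> y)))"

text \<open>Transitivity collapses the chains of isomorphisms and subgraphs hidden in
  \<open>family_bar\<close> and \<open>in_family\<close> into a single map.\<close>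

lemma embeds_trans:
  assumes "embeds h k" "embeds k l"
  shows "embeds h l"
proof -
  obtain \<phi> where p: "inj_on \<phi> (verts h)" "\<phi> ` slim h \<subseteq> slim k" "\<phi> ` fat h \<subseteq> fat k"
    "\<forall>x\<in>verts h. \<forall>y\<in>verts h. adj h x y \<longleftrightarrow> adj k (\<phi> x) (\<phi> y)"
    using assms(1) unfolding embeds_def by auto
  obtain \<psi> where q: "inj_on \<psi> (verts k)" "\<psi> ` slim k \<subseteq> slim l" "\<psi> ` fat k \<subseteq> fat l"
    "\<forall>x\<in>verts k. \<forall>y\<in>verts k. adj k x y \<longleftrightarrow> adj l (\<psi> x) (\<psi> y)"
    using assms(2) unfolding embeds_def by auto
  have sub: "\<phi> ` verts h \<subseteq> verts k" using p unfolding verts_def by blast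
  show ?thesis
    unfolding embeds_def
  proof (intro exI[of _ "\<psi> \<circ> \<phi>"] conjI)
    show "inj_on (\<psi> \<circ> \<phi>) (verts h)"
      using p(1) q(1) sub by (auto intro!: comp_inj_on intro: inj_on_subset)
    show "(\<psi> \<circ> \<phi>) ` slim h \<subseteq> slim l" "(\<psi> \<circ> \<phi>) ` fat h \<subseteq> fat l"
      using p q by (force simp: image_comp[symmetric])+
    show "\<forall>x\<in>verts h. \<forall>y\<in>verts h. adj h x y \<longleftrightarrow> adj l ((\<psi> \<circ> \<phi>) x) ((\<psi> \<circ> \<phi>) y)"
      using p(4) q(4) sub by (auto simp: image_subset_iff)
  qed
qed

lemma isomorphic_embeds:
  assumes "isomorphic h k"
  shows "embeds h k"
proof -
  obtain \<phi> where "hoffman_iso \<phi> h k" using assms unfolding isomorphic_def by blast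
  then show ?thesis
    unfolding hoffman_iso_def embeds_def bij_betw_def by (intro exI[of _ \<phi>]) simp
qed

lemma hoffman_subgraph_embeds: "hoffman_subgraph h k \<Longrightarrow> embeds h k"
  unfolding hoffman_subgraph_def embeds_def by (intro exI[of _ id]) auto

lemma isomorphic_refl: "hoffman_graph h \<Longrightarrow> isomorphic h h"
  unfolding isomorphic_def hoffman_iso_def by (auto intro!: exI[of _ id])

lemma embeds_isomorphic_subgraph:
  assumes "embeds h k" "hoffman_graph h" "hoffman_graph k"
  obtains g where "hoffman_subgraph g k" "isomorphic h g"
proof -
  obtain \<phi> where p: "inj_on \<phi> (verts h)" "\<phi> ` slim h \<subseteq> slim k" "\<phi> ` fat h \<subseteq> fat k"
    and adj': "\<forall>x\<in>verts h. \<forall>y\<in>verts h. adj h x y \<longleftrightarrow> adj k (\<phi> x) (\<phi> y)"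
    using assms(1) unfolding embeds_def by auto
  then have adj: "\<And>x y. x \<in> verts h \<Longrightarrow> y \<in> verts h \<Longrightarrow> adj h x y \<longleftrightarrow> adj k (\<phi> x) (\<phi> y)"
    by blast
  let ?g = "induced k (\<phi> ` slim h) (\<phi> ` fat h)"
  have sub: "hoffman_subgraph ?g k"
  proof (rule hoffman_subgraph_induced[OF assms(3) p(2,3)])
    fix f assume "f \<in> \<phi> ` fat h"
    then obtain f' where f': "f' \<in> fat h" "f = \<phi> f'" by blast
    then obtain y where "y \<in> slim h" "adj h f' y"
      using assms(2) unfolding hoffman_graph_def by blast
    then show "\<exists>x\<in>\<phi> ` slim h. adj k f x" using adj[of f' y] f' unfolding verts_def by blast
  qed
  moreover have "isomorphic h ?g"
    unfolding isomorphic_def hoffman_iso_def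
    using assms(2) sub p adj unfolding hoffman_subgraph_def
    by (auto intro!: exI[of _ \<phi>] simp: bij_betw_def verts_def image_Un)
  ultimately show ?thesis using that by blast
qed

lemma family_bar_subset_O: "family_bar \<H> \<subseteq> family_O"
  unfolding family_bar_def family_O_def by blast

lemma family_bar_embeds:
  fixes k :: "'a hoffman"
  assumes "k \<in> family_bar \<H>" "\<not> is_h2 k"
  obtains l where "l \<in> \<H>" "embeds k l"
proof -
  obtain h' g l :: "'a hoffman" where "hoffman_subgraph g h'" "isomorphic k g" "l \<in> \<H>" "isomorphic h' l"
    using assms unfolding family_bar_def in_family_def by blast
  then have "embeds k l"
    by (meson embeds_trans isomorphic_embeds hoffman_subgraph_embeds)
  then show ?thesis using that \<open>l \<in> \<H>\<close> by blast
qed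

lemma in_family_barI:
  assumes "k \<in> family_O" "embeds k l" "l \<in> \<H>" "\<H> \<subseteq> family_O"
  shows "in_family k (family_bar \<H>)"
proof -
  have hk: "hoffman_graph k" "hoffman_graph l" using assms family_O_hoffman_graph by blast+
  then obtain g where "hoffman_subgraph g l" "isomorphic k g"
    using embeds_isomorphic_subgraph[OF assms(2)] by blast
  moreover have "in_family l \<H>" using isomorphic_refl hk assms unfolding in_family_def by blast
  ultimately have "k \<in> family_bar \<H>" using assms unfolding family_bar_def by blast
  then show ?thesis using isomorphic_refl hk unfolding in_family_def by blast
qed

section \<open>Pieces with a single fat vertex\<close>

definition cone :: "('a \<times> 'a) set \<Rightarrow> 'a set \<Rightarrow> 'a \<Rightarrow> 'a hoffman" where
  "cone E C f = \<lparr>slim = C, fat = {f}, edges = E \<inter> C \<times> C \<union> C \<times> {f} \<union> {f} \<times> C\<rparr>"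

lemma cone_simps [simp]:
  "slim (cone E C f) = C" "fat (cone E C f) = {f}" "verts (cone E C f) = insert f C"
  "edges (cone E C f) = E \<inter> C \<times> C \<union> C \<times> {f} \<union> {f} \<times> C"
  by (auto simp: cone_def verts_def)

text \<open>Both parts of a decomposition contain slim vertices, since a fat vertex needs a slim
  neighbour. Connectedness of the complement gives a non-adjacent pair across the parts, but the two
  share exactly \<open>f\<close>, so the sum condition would make them adjacent.\<close>

lemma cone_in_family_O:
  assumes "finite C" "card C \<ge> 2" "sym E" "irrefl E" "f \<notin> C" "connected_on (- E) C"
  shows "cone E C f \<in> family_O"
proof -
  let ?h = "cone E C f"
  have ne: "C \<noteq> {}" using assms(2) by auto
  have hg: "hoffman_graph ?h"
    using assms ne by (auto simp: hoffman_graph_def sym_def irrefl_def)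
  have F: "fat_nbrs ?h x = {f}" if "x \<in> C" for x
    using that by (auto simp: fat_nbrs_def)
  have "\<not> decomposable ?h"
  proof
    assume "decomposable ?h"
    then obtain hs where sum: "is_sum ?h 2 hs" and nonempty: "\<forall>i<2. verts (hs i) \<noteq> {}"
      unfolding decomposable_def by blast
    have sl: "slim (hs i) \<noteq> {}" if "i < 2" for i
    proof -
      have "hoffman_graph (hs i)"
        using is_sumD(1)[OF sum that] unfolding hoffman_subgraph_def by blast
      moreover have "slim (hs i) \<union> fat (hs i) \<noteq> {}" using nonempty that unfolding verts_def by blast
      ultimately show ?thesis unfolding hoffman_graph_def by blast
    qed
    have "slim ?h = (\<Union>i<2. slim (hs i))" using is_sumD(2)[OF sum] .
    also have "{..<2} = {0, 1::nat}" by auto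
    finally have U: "C = slim (hs 0) \<union> slim (hs 1)" by simp
    have "slim (hs 0) \<inter> slim (hs 1) = {}" by (rule is_sumD(3)[OF sum]) auto
    then have "slim (hs 0) \<subset> C" using U sl[of 1] by auto
    then obtain u v where uv: "u \<in> slim (hs 0)" "v \<in> C - slim (hs 0)" "(u, v) \<in> - E"
      by (rule connected_on_edge_out[OF assms(6)]) (use sl[of 0] in auto)
    then have "v \<in> slim (hs 1)" using U by blast
    then have "card (fat_nbrs ?h u \<inter> fat_nbrs ?h v) = 1 \<longleftrightarrow> adj ?h u v"
      using uv(1) by (intro is_sumD(6)[OF sum, of 0 1]) auto
    moreover have "u \<in> C" "v \<in> C" using uv U by auto
    ultimately show False using F uv assms(5) by auto
  qed
  then have "indecomposable ?h" using hg unfolding indecomposable_def by blast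
  moreover have "fat_hoffman_graph ?h" using hg F unfolding fat_hoffman_graph_def by auto
  ultimately show ?thesis using assms(2) unfolding family_O_def by auto
qed

text \<open>The only trace of the family kept with \<open>F\<close>. It speaks of all co-connected
  sets, not just of maximal ones, so that it survives the deletion of vertices.\<close>

definition pieces_embed :: "'a hoffman set \<Rightarrow> 'a set \<Rightarrow> ('a \<times> 'a) set \<Rightarrow> ('a \<Rightarrow> 'a set) \<Rightarrow> bool" where
  "pieces_embed \<K> V E F \<longleftrightarrow>
     (\<forall>C f. C \<subseteq> V \<longrightarrow> card C \<ge> 2 \<longrightarrow> connected_on (- E) C \<longrightarrow> (\<forall>x\<in>C. F x = {f}) \<longrightarrow>
        (\<exists>k\<in>\<K>. embeds (cone E C f) k))"

text \<open>A cone over at least two slim vertices cannot embed into \<open>h_2\<close>, and every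
  other member of \<open>family_bar\<close> embeds into a member of the family itself.\<close>

lemma pieces_embed_family_bar:
  assumes "pieces_embed (family_bar \<H>) V E F"
  shows "pieces_embed \<H> V E F"
  unfolding pieces_embed_def
proof (intro allI impI)
  fix C f assume C: "C \<subseteq> V" "2 \<le> card C" "connected_on (- E) C" "\<forall>x\<in>C. F x = {f}"
  then obtain k where k: "k \<in> family_bar \<H>" "embeds (cone E C f) k"
    using assms unfolding pieces_embed_def by blast
  have "\<not> is_h2 k"
  proof
    assume "is_h2 k"
    then obtain x where x: "slim k = {x}" unfolding is_h2_def by auto
    obtain \<phi> where "inj_on \<phi> (insert f C)" "\<phi> ` C \<subseteq> {x}"
      using k(2) x unfolding embeds_def by auto
    then have "card C \<le> card {x}" by (meson card_inj_on_le finite.intros inj_on_subset subset_insertI)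
    then show False using C by simp
  qed
  then obtain l where "l \<in> \<H>" "embeds k l" using family_bar_embeds[OF k(1)] by blast
  then show "\<exists>k\<in>\<H>. embeds (cone E C f) k" using embeds_trans k(2) by blast
qed

section \<open>The fat system of a sum\<close>

locale shaped_sum =
  fixes h :: "'a hoffman" and k :: nat and hs :: "nat \<Rightarrow> 'a hoffman"
  assumes hoffman: "hoffman_graph h" and sum: "is_sum h k hs"
    and shape: "\<And>i. i < k \<Longrightarrow> O_shape (hs i)"
begin

lemma slim_piece: "x \<in> slim h \<Longrightarrow> \<exists>i<k. x \<in> slim (hs i)"
  using is_sumD(2)[OF sum] by auto

lemma slim_piece_subset: "i < k \<Longrightarrow> x \<in> slim (hs i) \<Longrightarrow> x \<in> slim h"
  using is_sumD(2)[OF sum] by auto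

lemma adj_piece:
  assumes "i < k" "x \<in> slim (hs i)" "y \<in> slim (hs i)"
  shows "adj (hs i) x y \<longleftrightarrow> adj h x y"
  using is_sumD(1)[OF sum assms(1)] assms unfolding hoffman_subgraph_def verts_def by auto

lemma fat_nbrs_piece:
  assumes "i < k" "x \<in> slim (hs i)"
  shows "fat_nbrs h x = fat (hs i)"
proof -
  have "fat_nbrs h x = fat_nbrs (hs i) x" using is_sumD(4)[OF sum assms] by simp
  then show ?thesis using shape[OF assms(1)] assms(2) unfolding O_shape_def fat_nbrs_def by auto
qed

lemma fat_piece_singleton:
  assumes "i < k" "x \<in> slim (hs i)" "y \<in> slim (hs i)" "x \<noteq> y"
  shows "\<exists>f. fat (hs i) = {f}"
proof -
  have "card (slim (hs i)) \<noteq> 1" using assms by (auto simp: card_1_singleton_iff)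
  then show ?thesis using shape[OF assms(1)] unfolding O_shape_def by (auto simp: card_1_singleton_iff)
qed

lemma finite_fat_nbrs: "finite (fat_nbrs h x)"
  using hoffman unfolding hoffman_graph_def fat_nbrs_def verts_def by auto

lemma cross_common:
  assumes "i < k" "j < k" "i \<noteq> j" "x \<in> slim (hs i)" "y \<in> slim (hs j)"
  shows "adj h x y \<longleftrightarrow> fat_nbrs h x \<inter> fat_nbrs h y \<noteq> {}"
proof -
  have "card (fat_nbrs h x \<inter> fat_nbrs h y) = 0 \<longleftrightarrow> fat_nbrs h x \<inter> fat_nbrs h y = {}"
    using finite_fat_nbrs by (simp add: card_eq_0_iff)
  then show ?thesis using is_sumD(5,6)[OF sum assms] by auto
qed

text \<open>Vertices of one piece have the same fat neighbours, and only one if the vertices are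
  distinct. For vertices of different pieces the sum condition equates adjacency with having a
  common fat neighbour and makes that neighbour unique.\<close>

lemma fat_system: "fat_system (slim h) (edges h) (fat_nbrs h)"
proof
  fix x assume "x \<in> slim h"
  then obtain i where i: "i < k" "x \<in> slim (hs i)" using slim_piece by blast
  show "finite (fat_nbrs h x)" by (rule finite_fat_nbrs)
  have "card (fat (hs i)) = 1 \<or> card (fat (hs i)) = 2" using shape[OF i(1)] unfolding O_shape_def by auto
  then show "fat_nbrs h x \<noteq> {}" "card (fat_nbrs h x) \<le> 2" using fat_nbrs_piece[OF i] by auto
next
  fix x y assume "x \<in> slim h" "y \<in> slim h"
  then obtain i j where i: "i < k" "x \<in> slim (hs i)" and j: "j < k" "y \<in> slim (hs j)"
    using slim_piece by meson
  {
    assume "(x, y) \<in> edges h"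
    show "\<exists>f. f \<in> fat_nbrs h x \<and> f \<in> fat_nbrs h y"
    proof (cases "i = j")
      case True
      have "card (fat (hs i)) = 1 \<or> card (fat (hs i)) = 2" using shape[OF i(1)] unfolding O_shape_def by auto
      then have "fat (hs i) \<noteq> {}" by auto
      then show ?thesis using True fat_nbrs_piece[OF i] fat_nbrs_piece[OF j] by auto
    next
      case False
      then show ?thesis using cross_common[OF i(1) j(1) False i(2) j(2)] \<open>(x, y) \<in> edges h\<close> by auto
    qed
  }
  {
    fix f assume "x \<noteq> y" "(x, y) \<notin> edges h" "f \<in> fat_nbrs h x" "f \<in> fat_nbrs h y"
    then have "i = j" using cross_common[OF i(1) j(1) _ i(2) j(2)] by auto
    then show "fat_nbrs h x = {f}"
      using fat_piece_singleton[OF i(1,2)] j \<open>x \<noteq> y\<close> \<open>f \<in> fat_nbrs h x\<close> fat_nbrs_piece[OF i] by force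
  }
  {
    fix f f' assume "x \<noteq> y" and f: "f \<in> fat_nbrs h x" "f \<in> fat_nbrs h y"
      "f' \<in> fat_nbrs h x" "f' \<in> fat_nbrs h y"
    show "f = f'"
    proof (cases "i = j")
      case True
      then show ?thesis
        using fat_piece_singleton[OF i(1,2)] j \<open>x \<noteq> y\<close> f fat_nbrs_piece[OF i] by force
    next
      case False
      have "card (fat_nbrs h x \<inter> fat_nbrs h y) \<le> Suc 0"
        using is_sumD(5)[OF sum i(1) j(1) False i(2) j(2)] by simp
      then show ?thesis using f finite_fat_nbrs by (auto simp: card_le_Suc0_iff_eq)
    qed
  }
qed

lemma singleton_nonadj:
  assumes "x \<in> slim h" "card (fat_nbrs h x) = 1"
  shows "\<exists>y\<in>slim h. y \<noteq> x \<and> fat_nbrs h y = fat_nbrs h x \<and> (x, y) \<notin> edges h"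
proof -
  obtain i where i: "i < k" "x \<in> slim (hs i)" using slim_piece assms by blast
  have "card (fat (hs i)) = 1" using assms(2) fat_nbrs_piece[OF i] by simp
  then obtain y where y: "y \<in> slim (hs i)" "y \<noteq> x" "\<not> adj (hs i) x y"
    using shape[OF i(1)] i(2) unfolding O_shape_def by auto
  then show ?thesis
    using adj_piece[OF i y(1)] fat_nbrs_piece[OF i] fat_nbrs_piece[OF i(1) y(1)]
      slim_piece_subset[OF i(1) y(1)] by auto
qed

text \<open>Non-adjacent vertices with a common fat neighbour lie in the same piece, so a path of
  non-adjacencies at \<open>f\<close> never leaves the piece it starts in.\<close>

lemma coconnected_in_piece:
  assumes "C \<subseteq> slim h" "C \<noteq> {}" "connected_on (- edges h) C" "\<forall>x\<in>C. fat_nbrs h x = {f}"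
  shows "\<exists>i<k. embeds (cone (edges h) C f) (hs i)"
proof -
  obtain x where x: "x \<in> C" using assms by blast
  then obtain i where i: "i < k" "x \<in> slim (hs i)" using slim_piece assms by blast
  have sub: "C \<subseteq> slim (hs i)"
  proof (rule connected_on_subset_closed[OF assms(3) i(2) x])
    fix u v assume u: "u \<in> slim (hs i)" "u \<in> C" and v: "v \<in> C" and uv: "(u, v) \<in> - edges h"
    obtain j where j: "j < k" "v \<in> slim (hs j)" using slim_piece assms v by blast
    then show "v \<in> slim (hs i)"
      using cross_common[OF i(1) j(1) _ u(1) j(2)] assms(4) u v uv by auto
  qed
  have f: "fat (hs i) = {f}" using fat_nbrs_piece[OF i] assms(4) x by auto
  have hg: "hoffman_graph (hs i)" using shape[OF i(1)] unfolding O_shape_def by blast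
  have "adj (hs i) x f" if "x \<in> C" for x
    using shape[OF i(1)] f sub that unfolding O_shape_def by auto
  moreover from this have "adj (hs i) f x" if "x \<in> C" for x
    using hg that unfolding hoffman_graph_def by (auto dest: symD)
  moreover have "f \<notin> C" using f sub hg unfolding hoffman_graph_def by auto
  moreover have "\<not> adj (hs i) f f" using hg f unfolding hoffman_graph_def by auto
  ultimately have "embeds (cone (edges h) C f) (hs i)"
    unfolding embeds_def using sub f adj_piece[OF i(1) subsetD[OF sub] subsetD[OF sub]]
    by (intro exI[of _ id]) auto
  then show ?thesis using i by blast
qed

end


lemma fat_system_restrict:
  assumes "fat_system V E F" "V' \<subseteq> V" "E' \<inter> V' \<times> V' = E \<inter> V' \<times> V'"
  shows "fat_system V' E' F"
proof -
  interpret fat_system V E F by fact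
  have E': "(x, y) \<in> E' \<longleftrightarrow> (x, y) \<in> E" if "x \<in> V'" "y \<in> V'" for x y
    using assms(3) that by blast
  show ?thesis
  proof
    show "finite (F x)" "F x \<noteq> {}" "card (F x) \<le> 2" if "x \<in> V'" for x
      using that assms(2) finite_F F_nonempty card_F_le by auto
    show "f = f'" if "x \<in> V'" "y \<in> V'" "x \<noteq> y" "f \<in> F x" "f \<in> F y" "f' \<in> F x" "f' \<in> F y"
      for x y f f' using that assms(2) common_unique by blast
    show "\<exists>f. f \<in> F x \<and> f \<in> F y" if "x \<in> V'" "y \<in> V'" "(x, y) \<in> E'" for x y
      using that assms(2) adj_common E' by blast
    show "F x = {f}" if "x \<in> V'" "y \<in> V'" "x \<noteq> y" "(x, y) \<notin> E'" "f \<in> F x" "f \<in> F y" for x y f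
      using that assms(2) nonadj_common E' by blast
  qed
qed

lemma pieces_embed_restrict:
  assumes "pieces_embed \<K> V E F" "V' \<subseteq> V" "E' \<inter> V' \<times> V' = E \<inter> V' \<times> V'"
  shows "pieces_embed \<K> V' E' F"
  unfolding pieces_embed_def
proof (intro allI impI)
  fix C f assume C: "C \<subseteq> V'" "2 \<le> card C" "connected_on (- E') C" "\<forall>x\<in>C. F x = {f}"
  have "E' \<inter> C \<times> C = E \<inter> C \<times> C" "- E' \<inter> C \<times> C = - E \<inter> C \<times> C" using C(1) assms(3) by blast+
  then have "cone E' C f = cone E C f" "connected_on (- E) C"
    using C(3) unfolding cone_def connected_on_def by auto
  then show "\<exists>k\<in>\<K>. embeds (cone E' C f) k"
    using assms(1,2) C unfolding pieces_embed_def by (metis order_trans)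
qed

section \<open>Building strict covers\<close>

text \<open>No piece consists of one slim and one fat vertex. This makes every rebuilt piece a
  member of \<open>family_O\<close>, and in the uniqueness proof it forces private fat vertices to
  exist.\<close>

definition saturated :: "'a set \<Rightarrow> ('a \<times> 'a) set \<Rightarrow> ('a \<Rightarrow> 'a set) \<Rightarrow> bool" where
  "saturated V E F \<longleftrightarrow>
     (\<forall>x\<in>V. card (F x) = 1 \<longrightarrow> (\<exists>y\<in>V. y \<noteq> x \<and> F y = F x \<and> (x, y) \<notin> E))"

locale saturated_system = fat_system V E F for V E and F :: "'a \<Rightarrow> 'a set" +
  fixes \<H> :: "'a hoffman set"
  assumes finite_V: "finite V" and E_subset: "E \<subseteq> V \<times> V" and sym_E: "sym E"
    and irrefl_E: "irrefl E" and F_fresh: "x \<in> V \<Longrightarrow> F x \<inter> V = {}"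
    and sat: "saturated V E F" and pieces: "pieces_embed \<H> V E F" and H_O: "\<H> \<subseteq> family_O"
begin

definition total :: "'a hoffman" where
  "total = \<lparr>slim = V, fat = \<Union> (F ` V),
     edges = E \<union> {(x, f). x \<in> V \<and> f \<in> F x} \<union> {(f, x). x \<in> V \<and> f \<in> F x}\<rparr>"

lemma total_simps [simp]: "slim total = V" "fat total = \<Union> (F ` V)"
  by (auto simp: total_def)

lemma total_adj_slim: "x \<in> V \<Longrightarrow> y \<in> V \<Longrightarrow> adj total x y \<longleftrightarrow> (x, y) \<in> E"
  using F_fresh by (auto simp: total_def)

lemma total_adj_fat: "x \<in> V \<Longrightarrow> f \<notin> V \<Longrightarrow> adj total x f \<longleftrightarrow> f \<in> F x"
  using E_subset F_fresh by (auto simp: total_def)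

lemma fat_nbrs_total: "x \<in> V \<Longrightarrow> fat_nbrs total x = F x"
  using F_fresh total_adj_fat unfolding fat_nbrs_def total_simps by blast

lemma hoffman_graph_total: "hoffman_graph total"
  unfolding hoffman_graph_def
proof (intro conjI ballI)
  show "finite (verts total)" using finite_V finite_F by (auto simp: verts_def)
  show "slim total \<inter> fat total = {}" using F_fresh by auto
  show "edges total \<subseteq> verts total \<times> verts total"
    using E_subset by (auto simp: total_def verts_def)
  show "sym (edges total)" using sym_E by (auto simp: total_def sym_def)
  show "irrefl (edges total)" using irrefl_E F_fresh by (auto simp: total_def irrefl_def)
next
  fix f assume "f \<in> fat total"
  then show "\<exists>y\<in>slim total. adj total f y" by (auto simp: total_def)
next
  fix f f' assume "f \<in> fat total" "f' \<in> fat total"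
  then have "f \<notin> V" "f' \<notin> V" using F_fresh by auto
  then show "\<not> adj total f f'" using E_subset by (auto simp: total_def)
qed

definition nonadj :: "('a \<times> 'a) set" where
  "nonadj = {(u, v). u \<in> V \<and> v \<in> V \<and> F u = F v \<and> card (F u) = 1 \<and> (u, v) \<notin> E}"

text \<open>The components of \<open>nonadj\<close> are the future pieces. A vertex with two fat
  neighbours has no \<open>nonadj\<close> step and forms a class alone. The intersection removes the
  reflexive pairs of the closure outside \<open>V\<close>.\<close>

definition same_piece :: "('a \<times> 'a) set" where
  "same_piece = nonadj\<^sup>* \<inter> V \<times> V"

lemma equiv_same_piece: "equiv V same_piece"
proof (rule equivI)
  show "same_piece \<subseteq> V \<times> V" by (auto simp: same_piece_def)
  show "refl_on V same_piece" by (auto simp: refl_on_def same_piece_def)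
  have "sym nonadj" using sym_E by (auto simp: nonadj_def sym_def)
  then have "sym (nonadj\<^sup>*)" by (rule sym_rtrancl)
  then show "sym same_piece" by (auto simp: same_piece_def sym_def)
  show "trans same_piece" by (auto simp: same_piece_def trans_def)
qed

lemma same_piece_F: "(x, y) \<in> same_piece \<Longrightarrow> F y = F x"
proof -
  assume "(x, y) \<in> same_piece"
  then have "(x, y) \<in> nonadj\<^sup>*" by (simp add: same_piece_def)
  then show "F y = F x" by (induction rule: rtrancl_induct) (auto simp: nonadj_def)
qed

text \<open>The first case becomes a copy of \<open>h_2\<close>. In the second, saturation supplies
  a second vertex of the class, and the class is connected in the complement by
  construction.\<close>

lemma piece_cases:
  assumes "C \<in> V // same_piece"
  obtains x p q where "x \<in> V" "C = {x}" "F x = {p, q}" "p \<noteq> q"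
  | f where "card C \<ge> 2" "C \<subseteq> V" "\<And>x. x \<in> C \<Longrightarrow> F x = {f}" "connected_on (- E) C"
proof -
  obtain x where x: "x \<in> V" "C = same_piece `` {x}" using assms by (rule quotientE)
  have CV: "C \<subseteq> V" using x by (auto simp: same_piece_def)
  have xC: "x \<in> C" using x by (auto simp: same_piece_def)
  have "card (F x) \<noteq> 0" using F_nonempty finite_F x by auto
  then consider "card (F x) = 2" | "card (F x) = 1" using card_F_le[OF x(1)] by linarith
  then show ?thesis
  proof cases
    case 1
    have "y = x" if "(x, y) \<in> nonadj\<^sup>*" for y
      using that 1 by (auto simp: nonadj_def elim: converse_rtranclE)
    then have "C = {x}" using x xC by (auto simp: same_piece_def)
    moreover obtain p q where "F x = {p, q}" "p \<noteq> q" using 1 by (auto simp: card_2_iff)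
    ultimately show ?thesis using that(1) x by blast
  next
    case 2
    obtain f where f: "F x = {f}" using 2 by (auto simp: card_1_singleton_iff)
    have CF: "F y = {f}" if "y \<in> C" for y using that x same_piece_F f by auto
    obtain y where y: "y \<in> V" "y \<noteq> x" "F y = F x" "(x, y) \<notin> E"
      using sat 2 x unfolding saturated_def by blast
    then have "(x, y) \<in> nonadj" using x 2 by (auto simp: nonadj_def)
    then have "y \<in> C" using x y by (auto simp: same_piece_def)
    then have "card {x, y} \<le> card C"
      using xC CV finite_V by (intro card_mono) (auto intro: finite_subset)
    then have "card C \<ge> 2" using y by simp
    moreover have "connected_on (- E) C"
      unfolding connected_on_def
    proof (intro ballI)
      fix u v assume uv: "u \<in> C" "v \<in> C"
      then have "(u, v) \<in> same_piece"
        using quotient_eq_iff[OF equiv_same_piece assms assms] by blast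
      then have "(u, v) \<in> nonadj\<^sup>*" by (simp add: same_piece_def)
      \<comment> \<open>Membership in \<open>C\<close> is carried along, because each step of the
        path must be seen to stay inside the class.\<close>
      then have "v \<in> C \<and> (u, v) \<in> (- E \<inter> C \<times> C)\<^sup>*"
      proof (induction rule: rtrancl_induct)
        case base
        then show ?case using uv by simp
      next
        case (step y z)
        have yC: "y \<in> C" using step by blast
        have "(x, y) \<in> nonadj\<^sup>*" using yC x by (auto simp: same_piece_def)
        then have "(x, z) \<in> nonadj\<^sup>*" using step by auto
        then have "z \<in> C" using x step by (auto simp: same_piece_def nonadj_def)
        moreover have "(y, z) \<in> - E" using step by (auto simp: nonadj_def)
        ultimately show ?case using step yC by (auto intro: rtrancl_into_rtrancl)
      qed
      then show "(u, v) \<in> (- E \<inter> C \<times> C)\<^sup>*" by blast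
    qed
    ultimately show ?thesis using that(2) CV CF by blast
  qed
qed

definition piece :: "'a set \<Rightarrow> 'a hoffman" where
  "piece C = induced total C (\<Union> (F ` C))"

lemma in_family_piece:
  assumes "C \<in> V // same_piece"
  shows "in_family (piece C) (family_bar \<H>)"
  using assms
proof (cases rule: piece_cases)
  case (1 x p q)
  have "p \<notin> V" "q \<notin> V" using 1 F_fresh[OF 1(1)] by auto
  moreover have "(x, x) \<notin> E" using irrefl_E by (auto simp: irrefl_def)
  ultimately have "piece C =
      \<lparr>slim = {x}, fat = {p, q}, edges = {(x, p), (p, x), (x, q), (q, x)}\<rparr>"
    using 1 E_subset by (auto simp: piece_def induced_def total_def)
  moreover have "distinct [x, p, q]" using 1 \<open>p \<notin> V\<close> \<open>q \<notin> V\<close> by auto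
  ultimately have h2: "is_h2 (piece C)" unfolding is_h2_def by blast
  then have "piece C \<in> family_bar \<H>" by (auto simp: family_bar_def)
  then show ?thesis
    using isomorphic_refl[OF is_h2_hoffman_graph[OF h2]] unfolding in_family_def by blast
next
  case (2 f)
  obtain x where x: "x \<in> C" using 2 by fastforce
  have f: "f \<notin> V" using F_fresh[of x] 2 x by auto
  have U: "\<Union> (F ` C) = {f}" using 2 x by auto
  have "edges total \<inter> (C \<union> {f}) \<times> (C \<union> {f}) = E \<inter> C \<times> C \<union> C \<times> {f} \<union> {f} \<times> C"
    using f E_subset 2(2,3) F_fresh by (auto simp: total_def)
  then have eq: "piece C = cone E C f"
    unfolding piece_def induced_def U cone_def by simp
  have "cone E C f \<in> family_O"
    using 2 f finite_V by (intro cone_in_family_O sym_E irrefl_E) (auto intro: finite_subset)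
  moreover obtain k where "k \<in> \<H>" "embeds (cone E C f) k"
    using pieces 2 unfolding pieces_embed_def by blast
  ultimately show ?thesis using in_family_barI H_O eq by metis
qed

text \<open>The critical sum condition is that vertices of different classes with a common fat
  neighbour are adjacent: otherwise that neighbour would be the only one of both, and
  \<open>nonadj\<close> would put them in one class.\<close>

lemma total_is_sum:
  "\<exists>n hs. is_sum total n hs \<and> (\<forall>i<n. in_family (hs i) (family_bar \<H>))"
proof -
  let ?Q = "V // same_piece"
  have "finite ?Q" using finite_V by (rule finite_quotient) (auto simp: same_piece_def)
  then obtain c where c: "bij_betw c {..<card ?Q} ?Q"
    using ex_bij_betw_nat_finite by (metis atLeast0LessThan)
  have cQ: "c i \<in> ?Q" if "i < card ?Q" for i using c that by (auto simp: bij_betw_def)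
  then have sub: "c i \<subseteq> V" if "i < card ?Q" for i
    using that Union_quotient[OF equiv_same_piece] by blast
  have UV: "(\<Union>i<card ?Q. c i) = V"
    using c Union_quotient[OF equiv_same_piece] by (simp add: bij_betw_def)
  have disj: "c i \<inter> c j = {}" if "i < card ?Q" "j < card ?Q" "i \<noteq> j" for i j
    using quotient_disj[OF equiv_same_piece cQ[OF that(1)] cQ[OF that(2)]] c that
    by (auto simp: bij_betw_def inj_on_def)
  have "is_sum total (card ?Q) (\<lambda>i. piece (c i))"
    unfolding is_sum_def
  proof (intro conjI allI impI ballI)
    fix i assume "i < card ?Q"
    then have "c i \<subseteq> V" by (rule sub)
    then show "hoffman_subgraph (piece (c i)) total"
      unfolding piece_def
      by (intro hoffman_subgraph_induced hoffman_graph_total) (auto simp: total_def)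
  next
    show "slim total = (\<Union>i<card ?Q. slim (piece (c i)))" using UV by (simp add: piece_def)
    have "(\<Union>i<card ?Q. c i \<union> \<Union> (F ` c i)) =
        (\<Union>i<card ?Q. c i) \<union> \<Union> (F ` (\<Union>i<card ?Q. c i))"
      by auto
    then have "(\<Union>i<card ?Q. c i \<union> \<Union> (F ` c i)) = V \<union> \<Union> (F ` V)"
      by (simp only: UV)
    then show "verts total = (\<Union>i<card ?Q. verts (piece (c i)))"
      by (simp add: verts_def piece_def)
  next
    fix i j assume "i < card ?Q" "j < card ?Q" "i \<noteq> j"
    then show "slim (piece (c i)) \<inter> slim (piece (c j)) = {}" using disj by (simp add: piece_def)
  next
    fix i x assume i: "i < card ?Q" and "x \<in> slim (piece (c i))"
    then have x: "x \<in> c i" by (simp add: piece_def)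
    have "\<Union> (F ` c i) \<subseteq> fat total" using sub[OF i] by auto
    then have "fat_nbrs (piece (c i)) x = fat_nbrs total x \<inter> \<Union> (F ` c i)"
      unfolding piece_def using x by (rule fat_nbrs_induced)
    then show "fat_nbrs (piece (c i)) x = fat_nbrs total x"
      using x fat_nbrs_total[OF subsetD[OF sub[OF i] x]] by auto
  next
    fix i j x y assume ij: "i < card ?Q" "j < card ?Q" "i \<noteq> j"
      and "x \<in> slim (piece (c i))" "y \<in> slim (piece (c j))"
    then have xy: "x \<in> c i" "y \<in> c j" by (auto simp: piece_def)
    have V: "x \<in> V" "y \<in> V" using xy sub ij by auto
    have ne: "x \<noteq> y" using xy disj ij by auto
    have npiece: "(x, y) \<notin> same_piece"
      using quotient_eq_iff[OF equiv_same_piece cQ[OF ij(1)] cQ[OF ij(2)] xy] ij c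
      by (auto simp: bij_betw_def inj_on_def)
    have fin: "finite (F x \<inter> F y)" using finite_F V by auto
    have FF: "fat_nbrs total x \<inter> fat_nbrs total y = F x \<inter> F y" using V fat_nbrs_total by auto
    have le: "card (F x \<inter> F y) \<le> Suc 0"
      using common_unique[OF V ne] fin by (auto simp: card_le_Suc0_iff_eq)
    then show "card (fat_nbrs total x \<inter> fat_nbrs total y) \<le> 1" using FF by simp
    have "(x, y) \<in> E" if f: "f \<in> F x" "f \<in> F y" for f
    proof (rule ccontr)
      assume n: "(x, y) \<notin> E"
      then have "(y, x) \<notin> E" using sym_E by (auto dest: symD)
      then have "F x = {f}" "F y = {f}"
        using nonadj_common[OF V ne n f] nonadj_common[OF V(2,1) ne[symmetric] _ f(2,1)] by auto
      then have "(x, y) \<in> nonadj" using V n by (auto simp: nonadj_def)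
      then show False using npiece V by (auto simp: same_piece_def)
    qed
    moreover have "card (F x \<inter> F y) = 1 \<longleftrightarrow> F x \<inter> F y \<noteq> {}"
      using le fin by (auto simp: le_Suc_eq card_eq_0_iff)
    ultimately show "(card (fat_nbrs total x \<inter> fat_nbrs total y) = 1) = adj total x y"
      unfolding FF total_adj_slim[OF V] using adj_common[OF V] by auto
  qed
  then show ?thesis using in_family_piece cQ by blast
qed

end

text \<open>A slim vertex with a single fat neighbour that is adjacent to every other vertex attached
  only there would form a piece on its own, which is not in \<^const>\<open>family_O\<close>; a private second fat
  neighbour turns it into a copy of \<open>\<hh>\<^sub>2\<close>.\<close>

lemma ex_saturated_system:
  fixes F :: "'a::infinite \<Rightarrow> 'a set"
  assumes sys: "fat_system V E F" and fin: "finite V" and sym: "sym E"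
    and fresh: "\<And>x. x \<in> V \<Longrightarrow> F x \<inter> V = {}" and pieces: "pieces_embed \<H> V E F"
  obtains G where "fat_system V E G" "\<And>x. x \<in> V \<Longrightarrow> G x \<inter> V = {}" "saturated V E G"
    "pieces_embed \<H> V E G" "agree_on V G F"
proof -
  interpret fat_system V E F by (rule sys)
  let ?X = "V \<union> \<Union> (F ` V)"
  have "finite ?X" using fin finite_F by auto
  then have "infinite (UNIV - ?X)" by (simp add: infinite_UNIV)
  \<comment> \<open>One new vertex is reserved for each element of \<open>V\<close>, although only
    the lone ones receive theirs.\<close>
  from infinite_arbitrarily_large[OF this, of "card V"]
  obtain B where B: "finite B" "card B = card V" "B \<subseteq> UNIV - ?X" by auto
  then obtain \<nu> where \<nu>: "bij_betw \<nu> V B" using finite_same_card_bij[OF fin] by metis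
  have \<nu>_new: "\<nu> x \<notin> V" "y \<in> V \<Longrightarrow> \<nu> x \<notin> F y" if "x \<in> V" for x y
    using that B(3) \<nu> by (auto simp: bij_betw_def)
  define lone where "lone x \<longleftrightarrow> card (F x) = 1 \<and> (\<forall>y\<in>V. y \<noteq> x \<longrightarrow> F y = F x \<longrightarrow> (x, y) \<in> E)" for x
  define G where "G x = (if lone x then insert (\<nu> x) (F x) else F x)" for x
  have FG: "F x \<subseteq> G x" for x by (auto simp: G_def)
  have card_G: "card (G x) = (if lone x then 2 else card (F x))" if "x \<in> V" for x
    using that \<nu>_new finite_F by (auto simp: G_def lone_def)
  \<comment> \<open>A private vertex belongs to one set only, so distinct vertices share in
    \<open>G\<close> exactly what they share in \<open>F\<close>.\<close>
  have common: "f \<in> F x \<and> f \<in> F y" if "x \<in> V" "y \<in> V" "x \<noteq> y" "f \<in> G x" "f \<in> G y" for x y f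
  proof -
    have "\<nu> x \<noteq> \<nu> y" using that \<nu> by (auto simp: bij_betw_def inj_on_def)
    then show ?thesis using that \<nu>_new by (auto simp: G_def split: if_splits)
  qed
  have single: "F x = {f}" if "x \<in> V" "G x = {f}" for x f
    using card_G[OF that(1)] that by (auto simp: G_def split: if_splits)
  have "fat_system V E G"
  proof
    show "finite (G x)" "G x \<noteq> {}" "card (G x) \<le> 2" if "x \<in> V" for x
      using that finite_F F_nonempty card_F_le card_G FG by (auto simp: G_def)
    show "f = f'" if "x \<in> V" "y \<in> V" "x \<noteq> y" "f \<in> G x" "f \<in> G y" "f' \<in> G x" "f' \<in> G y" for x y f f'
      using that common common_unique by meson
    show "\<exists>f. f \<in> G x \<and> f \<in> G y" if "x \<in> V" "y \<in> V" "(x, y) \<in> E" for x y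
      using adj_common[OF that] FG by blast
    show "G x = {f}" if xy: "x \<in> V" "y \<in> V" "x \<noteq> y" "(x, y) \<notin> E" "f \<in> G x" "f \<in> G y" for x y f
    proof -
      have f: "f \<in> F x" "f \<in> F y" using common xy by blast+
      have "(y, x) \<notin> E" using xy sym by (auto dest: symD)
      then have "F x = {f}" "F y = {f}"
        using nonadj_common[OF xy(1-4) f] nonadj_common[OF xy(2,1) xy(3)[symmetric] _ f(2,1)] by auto
      moreover from this have "\<not> lone x" using xy unfolding lone_def by auto
      ultimately show ?thesis by (simp add: G_def)
    qed
  qed
  moreover have "G x \<inter> V = {}" if "x \<in> V" for x
    using fresh[OF that] \<nu>_new that by (auto simp: G_def)
  moreover have "saturated V E G"
    unfolding saturated_def
  proof (intro ballI impI)
    fix x assume x: "x \<in> V" "card (G x) = 1"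
    then have nl: "\<not> lone x" "card (F x) = 1" using card_G by (auto split: if_splits)
    then obtain y where y: "y \<in> V" "y \<noteq> x" "F y = F x" "(x, y) \<notin> E" unfolding lone_def by auto
    then have "(y, x) \<notin> E" using sym by (auto dest: symD)
    then have "\<not> lone y" using x y unfolding lone_def by auto
    then show "\<exists>y\<in>V. y \<noteq> x \<and> G y = G x \<and> (x, y) \<notin> E" using nl y by (auto simp: G_def)
  qed
  moreover have "pieces_embed \<H> V E G"
    using pieces single unfolding pieces_embed_def by (meson subsetD)
  moreover have "agree_on V G F"
    unfolding agree_on_def
  proof (intro ballI impI)
    fix x y z assume xyz: "x \<in> V" "y \<in> V" "z \<in> V" "x \<noteq> y"
    have "f \<in> F z" if "f \<in> G x" "f \<in> G y" "f \<in> G z" for f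
      using common[of x z f] common[of y z f] xyz that by blast
    then show "joined G x y z = joined F x y z"
      unfolding joined_def using common[OF xyz(1,2,4)] FG by blast
  qed
  ultimately show ?thesis using that by blast
qed


section \<open>From covers to fat systems and strict covers\<close>

lemma cover_shaped_sum:
  assumes "cover \<K> g h" "\<K> \<subseteq> family_O"
  obtains n hs where "shaped_sum h n hs" "\<And>i. i < n \<Longrightarrow> in_family (hs i) \<K>"
proof -
  obtain n hs where sum: "is_sum h n hs" and fam: "\<And>i. i < n \<Longrightarrow> in_family (hs i) \<K>"
    using assms(1) unfolding cover_def by blast
  have "O_shape (hs i)" if "i < n" for i
    using fam[OF that] assms(2) family_O_shape O_shape_isomorphic unfolding in_family_def by blast
  moreover have "hoffman_graph h" using assms(1) unfolding cover_def hoffman_subgraph_def by blast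
  ultimately have "shaped_sum h n hs" using sum by (simp add: shaped_sum_def)
  then show ?thesis using that fam by blast
qed

lemma slim_subgraph_edges:
  assumes "hoffman_subgraph g h" "fat g = {}"
  shows "slim g \<subseteq> slim h" "edges g \<inter> slim g \<times> slim g = edges h \<inter> slim g \<times> slim g"
  using assms unfolding hoffman_subgraph_def verts_def by auto

text \<open>The cover may have slim vertices outside \<open>g\<close>, and the first two properties
  restrict to \<open>slim g\<close>. Saturation is claimed only for equal slim sets, since the
  required non-neighbour could otherwise lie outside \<open>g\<close>.\<close>

lemma cover_fat_system:
  assumes "cover \<K> g h" "\<K> \<subseteq> family_O" "fat g = {}"
  shows "fat_system (slim g) (edges g) (fat_nbrs h)"
    and "pieces_embed \<K> (slim g) (edges g) (fat_nbrs h)"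
    and "slim h = slim g \<Longrightarrow> saturated (slim g) (edges g) (fat_nbrs h)"
proof -
  obtain n hs where "shaped_sum h n hs" and fam: "\<And>i. i < n \<Longrightarrow> in_family (hs i) \<K>"
    using cover_shaped_sum[OF assms(1,2)] by blast
  interpret shaped_sum h n hs by fact
  have sub: "slim g \<subseteq> slim h" "edges g \<inter> slim g \<times> slim g = edges h \<inter> slim g \<times> slim g"
    using slim_subgraph_edges assms(1,3) unfolding cover_def by blast+
  show "fat_system (slim g) (edges g) (fat_nbrs h)"
    using fat_system_restrict[OF fat_system sub] .
  have "pieces_embed \<K> (slim h) (edges h) (fat_nbrs h)"
    unfolding pieces_embed_def
  proof (intro allI impI)
    fix C f assume C: "C \<subseteq> slim h" "2 \<le> card C" "connected_on (- edges h) C"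
      "\<forall>x\<in>C. fat_nbrs h x = {f}"
    then have "C \<noteq> {}" by auto
    then obtain i where i: "i < n" "embeds (cone (edges h) C f) (hs i)"
      using coconnected_in_piece C by blast
    then obtain k where "k \<in> \<K>" "isomorphic (hs i) k" using fam unfolding in_family_def by blast
    then show "\<exists>k\<in>\<K>. embeds (cone (edges h) C f) k"
      using i isomorphic_embeds embeds_trans by blast
  qed
  then show "pieces_embed \<K> (slim g) (edges g) (fat_nbrs h)"
    using pieces_embed_restrict sub by blast
  show "saturated (slim g) (edges g) (fat_nbrs h)" if "slim h = slim g"
    unfolding saturated_def
  proof (intro ballI impI)
    fix x assume x: "x \<in> slim g" "card (fat_nbrs h x) = 1"
    then obtain y where y: "y \<in> slim g" "y \<noteq> x" "fat_nbrs h y = fat_nbrs h x" "(x, y) \<notin> edges h"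
      using singleton_nonadj[of x] \<open>slim h = slim g\<close> by auto
    moreover have "(x, y) \<notin> edges g" using sub(2) x y by blast
    ultimately show "\<exists>y\<in>slim g. y \<noteq> x \<and> fat_nbrs h y = fat_nbrs h x \<and> (x, y) \<notin> edges g"
      by blast
  qed
qed

text \<open>Restrict the fat system of the cover to \<open>g\<close>, saturate it and rebuild the
  pieces. The choice \<open>\<K> = \<H>\<close> gives existence of strict covers;
  \<open>\<K> = family_bar \<H>\<close> turns a cover of \<open>g\<close> into a strict cover of
  \<open>g\<close> minus a vertex with the same triples.\<close>

lemma ex_strict_cover:
  fixes \<H> :: "'a::infinite hoffman set"
  assumes H: "\<H> \<subseteq> family_O" and cov: "cover \<K> g h" and K: "\<K> = \<H> \<or> \<K> = family_bar \<H>"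
    and g: "slim_graph g"
  obtains k where "strict_cover (family_bar \<H>) g k" "agree_on (slim g) (fat_nbrs k) (fat_nbrs h)"
proof -
  have fat: "fat g = {}" and hg: "hoffman_graph g" using g unfolding slim_graph_def by auto
  have KO: "\<K> \<subseteq> family_O" using K H family_bar_subset_O by blast
  have sub: "hoffman_subgraph g h" using cov unfolding cover_def by blast
  have pieces: "pieces_embed \<H> (slim g) (edges g) (fat_nbrs h)"
    using cover_fat_system(2)[OF cov KO fat] K pieces_embed_family_bar by blast
  have fin: "finite (slim g)" and sym: "sym (edges g)" and irr: "irrefl (edges g)"
    and E: "edges g \<subseteq> slim g \<times> slim g"
    using hg fat unfolding hoffman_graph_def verts_def by auto
  have fresh: "fat_nbrs h x \<inter> slim g = {}" for x
    using sub unfolding hoffman_subgraph_def hoffman_graph_def fat_nbrs_def by blast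
  obtain G where G: "fat_system (slim g) (edges g) G" "\<And>x. x \<in> slim g \<Longrightarrow> G x \<inter> slim g = {}"
    "saturated (slim g) (edges g) G" "pieces_embed \<H> (slim g) (edges g) G"
    "agree_on (slim g) G (fat_nbrs h)"
    using ex_saturated_system[OF cover_fat_system(1)[OF cov KO fat] fin sym fresh pieces] by blast
  interpret saturated_system "slim g" "edges g" G \<H>
    using G fin sym irr E H by (intro saturated_system.intro saturated_system_axioms.intro) auto
  have "edges g = edges total \<inter> verts g \<times> verts g"
    using E fat total_adj_slim unfolding verts_def by auto
  then have "hoffman_subgraph g total"
    unfolding hoffman_subgraph_def using hg hoffman_graph_total fat by simp
  then have "strict_cover (family_bar \<H>) g total"
    unfolding strict_cover_def cover_def using total_is_sum by simp
  moreover have "agree_on (slim g) (fat_nbrs total) (fat_nbrs h)"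
    using G(5) fat_nbrs_total unfolding agree_on_def joined_def by simp
  ultimately show ?thesis using that by blast
qed

section \<open>Equivalence of strict covers\<close>

locale agreeing_systems = S: fat_system V E F + T: fat_system V E G
  for V :: "'a set" and E F G +
  assumes irr: "irrefl E" and nbr: "\<And>x. x \<in> V \<Longrightarrow> \<exists>y\<in>V. (x, y) \<in> E"
    and agree: "agree_on V F G" and sat: "saturated V E G"
begin

lemma fat_class_transfer_pair:
  assumes y: "y \<in> V" "f \<in> F y" and z: "z \<in> V" "f \<in> F z" and "y \<noteq> z"
  shows "\<exists>f'. \<forall>x\<in>V. f \<in> F x \<longleftrightarrow> f' \<in> G x"
proof -
  have "joined F y z z" using y z by (auto intro: joinedI)
  then have "joined G y z z" using agree y z \<open>y \<noteq> z\<close> unfolding agree_on_def by blast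
  then obtain f' where f': "f' \<in> G y" "f' \<in> G z" unfolding joined_def by blast
  have "f \<in> F x \<longleftrightarrow> f' \<in> G x" if "x \<in> V" for x
  proof -
    have "f \<in> F x \<longleftrightarrow> joined F y z x"
      using S.common_unique[OF y(1) z(1) \<open>y \<noteq> z\<close> y(2) z(2)] y z unfolding joined_def by blast
    also have "\<dots> \<longleftrightarrow> joined G y z x" using agree y z that \<open>y \<noteq> z\<close> unfolding agree_on_def by blast
    also have "\<dots> \<longleftrightarrow> f' \<in> G x"
      using T.common_unique[OF y(1) z(1) \<open>y \<noteq> z\<close> f'] f' unfolding joined_def by blast
    finally show ?thesis .
  qed
  then show ?thesis by blast
qed

text \<open>The hard case is \<open>f\<close> private to \<open>x\<close>. A neighbour of
  \<open>x\<close> gives a second, shared \<open>f1\<close> with partner \<open>f1'\<close> in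
  \<open>G x\<close>. If \<open>f1'\<close> were alone there, saturation would give a non-neighbour
  of \<open>x\<close> at \<open>f1'\<close>, hence at \<open>f1\<close>, and \<open>F x\<close>
  could not have two elements. So \<open>G x\<close> has another element, and agreement on pairs
  shows it to be private too.\<close>

lemma fat_class_transfer:
  assumes x: "x \<in> V" "f \<in> F x"
  shows "\<exists>f'. \<forall>y\<in>V. f \<in> F y \<longleftrightarrow> f' \<in> G y"
proof (cases "\<exists>z\<in>V. z \<noteq> x \<and> f \<in> F z")
  case True
  then show ?thesis using fat_class_transfer_pair x by blast
next
  case False
  obtain y where y: "y \<in> V" "(x, y) \<in> E" using nbr x by blast
  then have xy: "x \<noteq> y" using irr by (auto simp: irrefl_def)
  obtain f1 where f1: "f1 \<in> F x" "f1 \<in> F y" using S.adj_common[OF x(1) y] by blast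
  then have "f \<noteq> f1" using False y xy by auto
  then have Fx: "F x = {f, f1}" using S.F_two x f1 by blast
  obtain f1' where f1': "\<forall>z\<in>V. f1 \<in> F z \<longleftrightarrow> f1' \<in> G z"
    using fat_class_transfer_pair[OF x(1) f1(1) y(1) f1(2) xy] by blast
  have "G x \<noteq> {f1'}"
  proof
    assume Gx: "G x = {f1'}"
    then obtain z where z: "z \<in> V" "z \<noteq> x" "G z = G x" "(x, z) \<notin> E"
      using sat x unfolding saturated_def by force
    then have "f1 \<in> F z" using f1' Gx by auto
    then show False using S.nonadj_common[OF x(1) z(1) z(2)[symmetric] z(4) f1(1)] Fx \<open>f \<noteq> f1\<close> by auto
  qed
  moreover have "f1' \<in> G x" using f1' f1 x by blast
  ultimately obtain f' where f': "f' \<in> G x" "f' \<noteq> f1'" by blast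
  have "f' \<notin> G z" if z: "z \<in> V" "z \<noteq> x" for z
  proof
    assume "f' \<in> G z"
    then have "joined G x z z" using f' by (auto intro: joinedI)
    then have "joined F x z z" using agree x z unfolding agree_on_def by auto
    then have "f1 \<in> F z" using Fx False z unfolding joined_def by auto
    then have "f1' \<in> G z" using f1' z by blast
    then show False
      using T.common_unique[OF x(1) z(1) z(2)[symmetric]] f' \<open>f1' \<in> G x\<close> \<open>f' \<in> G z\<close> by blast
  qed
  then have "f \<in> F z \<longleftrightarrow> f' \<in> G z" if "z \<in> V" for z
    using False f' x that by (cases "z = x") auto
  then show ?thesis by blast
qed

text \<open>Two such fat vertices would exhaust \<open>F x\<close>; a neighbour of \<open>x\<close>
  shares one of them, hence both, against uniqueness of the common neighbour.\<close>

lemma fat_class_inj: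
  assumes x: "x \<in> V" "f \<in> F x" and same: "\<forall>y\<in>V. f \<in> F y \<longleftrightarrow> f' \<in> F y"
  shows "f = f'"
proof (rule ccontr)
  assume ne: "f \<noteq> f'"
  have f': "f' \<in> F x" using x same by blast
  obtain y where y: "y \<in> V" "(x, y) \<in> E" using nbr x by blast
  then have xy: "x \<noteq> y" using irr by (auto simp: irrefl_def)
  obtain f1 where f1: "f1 \<in> F x" "f1 \<in> F y" using S.adj_common[OF x(1) y] by blast
  have "F x = {f, f'}" using S.F_two x f' ne by blast
  then have "f \<in> F y" "f' \<in> F y" using f1 same y by auto
  then show False using S.common_unique[OF x(1) y(1) xy x(2) _ f'] ne by blast
qed

end

lemma fat_adj:
  assumes "hoffman_graph h" "f \<in> fat h"
  shows "\<exists>x\<in>slim h. f \<in> fat_nbrs h x"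
proof -
  obtain x where "x \<in> slim h" "adj h f x" using assms unfolding hoffman_graph_def by auto
  then show ?thesis using assms unfolding hoffman_graph_def fat_nbrs_def by (auto dest: symD)
qed

text \<open>Fat vertices of the two covers are matched by equal slim neighbourhoods.
  \<open>fat_class_transfer\<close> in both directions gives partners, \<open>fat_class_inj\<close>
  makes them unique, and slim adjacency is that of \<open>g\<close> in both covers.\<close>

lemma equivalent_covers_if_agree:
  assumes h: "hoffman_subgraph g h" "slim h = slim g" and h': "hoffman_subgraph g h'" "slim h' = slim g"
    and fat: "fat g = {}"
    and FG: "agreeing_systems (slim g) (edges g) (fat_nbrs h) (fat_nbrs h')"
    and GF: "agreeing_systems (slim g) (edges g) (fat_nbrs h') (fat_nbrs h)"
  shows "equivalent_covers g h h'"
proof -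
  interpret FG: agreeing_systems "slim g" "edges g" "fat_nbrs h" "fat_nbrs h'" by (rule FG)
  interpret GF: agreeing_systems "slim g" "edges g" "fat_nbrs h'" "fat_nbrs h" by (rule GF)
  let ?V = "slim g"
  let ?M = "\<lambda>f f'. \<forall>x\<in>?V. f \<in> fat_nbrs h x \<longleftrightarrow> f' \<in> fat_nbrs h' x"
  have hg: "hoffman_graph h" "hoffman_graph h'" using h h' unfolding hoffman_subgraph_def by auto
  have disj: "?V \<inter> fat h = {}" "?V \<inter> fat h' = {}"
    using hg h(2) h'(2) unfolding hoffman_graph_def by auto
  have wit: "\<exists>x\<in>?V. f \<in> fat_nbrs h x" if "f \<in> fat h" for f using fat_adj[OF hg(1) that] h(2) by simp
  have wit': "\<exists>x\<in>?V. f \<in> fat_nbrs h' x" if "f \<in> fat h'" for f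
    using fat_adj[OF hg(2) that] h'(2) by simp
  have ex: "\<exists>f'\<in>fat h'. ?M f f'" if f: "f \<in> fat h" for f
  proof -
    obtain x where x: "x \<in> ?V" "f \<in> fat_nbrs h x" using wit[OF f] by blast
    then obtain f' where "?M f f'" using FG.fat_class_transfer by blast
    moreover from this have "f' \<in> fat h'" using x unfolding fat_nbrs_def by blast
    ultimately show ?thesis by blast
  qed
  have ex': "\<exists>f\<in>fat h. ?M f f'" if f': "f' \<in> fat h'" for f'
  proof -
    obtain x where x: "x \<in> ?V" "f' \<in> fat_nbrs h' x" using wit'[OF f'] by blast
    then obtain f where f: "\<forall>x\<in>?V. f' \<in> fat_nbrs h' x \<longleftrightarrow> f \<in> fat_nbrs h x"
      using GF.fat_class_transfer by blast
    then have "f \<in> fat h" using x unfolding fat_nbrs_def by blast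
    then show ?thesis using f by blast
  qed
  have uniq: "f1 = f2" if "f1 \<in> fat h" "?M f1 f'" "?M f2 f'" for f1 f2 f'
    using wit[OF that(1)] FG.fat_class_inj that(2,3) by blast
  have uniq': "f1 = f2" if "f1 \<in> fat h'" "?M f f1" "?M f f2" for f1 f2 f
    using wit'[OF that(1)] GF.fat_class_inj that(2,3) by blast
  obtain m where m: "\<And>f. f \<in> fat h \<Longrightarrow> m f \<in> fat h' \<and> ?M f (m f)" using ex by metis
  define \<phi> where "\<phi> x = (if x \<in> ?V then x else m x)" for x
  have slim: "\<phi> x = x" if "x \<in> ?V" for x using that by (simp add: \<phi>_def)
  have fat_\<phi>: "\<phi> f = m f" if "f \<in> fat h" for f using that disj by (auto simp: \<phi>_def)
  have im_slim: "\<phi> ` slim h = slim h'" using slim h(2) h'(2) by simp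
  have im_fat: "\<phi> ` fat h = fat h'"
  proof
    show "\<phi> ` fat h \<subseteq> fat h'" using m fat_\<phi> by auto
    show "fat h' \<subseteq> \<phi> ` fat h"
    proof
      fix f' assume f': "f' \<in> fat h'"
      then obtain f where f: "f \<in> fat h" "?M f f'" using ex' by blast
      then have "f' = m f" using uniq'[OF f' f(2)] m by blast
      then show "f' \<in> \<phi> ` fat h" using f fat_\<phi> by auto
    qed
  qed
  have "inj_on \<phi> (verts h)"
  proof (rule inj_onI)
    fix x y assume xy: "x \<in> verts h" "y \<in> verts h" "\<phi> x = \<phi> y"
    have cases: "z \<in> ?V \<or> z \<in> fat h" if "z \<in> verts h" for z using that h(2) by (auto simp: verts_def)
    have "x = y" if "x \<in> fat h" "y \<in> fat h"
    proof -
      have "m x = m y" using xy that fat_\<phi> by simp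
      then have "?M x (m x)" "?M y (m x)" using m that by auto
      then show ?thesis using uniq that(1) by blast
    qed
    moreover have "\<phi> z \<in> fat h'" "\<phi> z \<notin> ?V" if "z \<in> fat h" for z using m that fat_\<phi> disj by auto
    ultimately show "x = y" using cases[OF xy(1)] cases[OF xy(2)] xy(3) slim by metis
  qed
  then have bij: "bij_betw \<phi> (verts h) (verts h')"
    using im_slim im_fat by (simp add: bij_betw_def verts_def image_Un)
  have sf: "adj h x f \<longleftrightarrow> adj h' x (m f)" if "x \<in> ?V" "f \<in> fat h" for x f
    using m[OF that(2)] that unfolding fat_nbrs_def by auto
  have sym: "adj h x y \<longleftrightarrow> adj h y x" "adj h' x y \<longleftrightarrow> adj h' y x" for x y
    using hg unfolding hoffman_graph_def by (auto dest: symD)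
  have ss: "adj h x y \<longleftrightarrow> adj h' x y" if "x \<in> ?V" "y \<in> ?V" for x y
    using slim_subgraph_edges(2)[OF h(1) fat] slim_subgraph_edges(2)[OF h'(1) fat] that by blast
  have "adj h x y \<longleftrightarrow> adj h' (\<phi> x) (\<phi> y)" if xy: "x \<in> verts h" "y \<in> verts h" for x y
  proof -
    consider "x \<in> ?V" "y \<in> ?V" | "x \<in> ?V" "y \<in> fat h" | "x \<in> fat h" "y \<in> ?V" | "x \<in> fat h" "y \<in> fat h"
      using xy h(2) by (auto simp: verts_def)
    then show ?thesis
    proof cases
      case 1
      then show ?thesis using ss slim by simp
    next
      case 2
      then show ?thesis using sf slim fat_\<phi> by simp
    next
      case 3
      then show ?thesis using sf[of y x] slim fat_\<phi> sym by metis
    next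
      case 4
      then show ?thesis using m fat_\<phi> hg unfolding hoffman_graph_def by simp
    qed
  qed
  then have "hoffman_iso \<phi> h h'" using bij im_slim im_fat unfolding hoffman_iso_def by blast
  moreover have "\<forall>x\<in>verts g. \<phi> x = x" using slim fat by (simp add: verts_def)
  ultimately show ?thesis unfolding equivalent_covers_def by blast
qed

section \<open>Uniqueness from vertex deletions\<close>

lemma joined_if_equivalent:
  assumes "equivalent_covers g h h'" "slim h = slim g" "x \<in> slim g" "y \<in> slim g" "z \<in> slim g"
    and "joined (fat_nbrs h) x y z"
  shows "joined (fat_nbrs h') x y z"
proof -
  obtain \<phi> where iso: "hoffman_iso \<phi> h h'" and id: "\<forall>x\<in>verts g. \<phi> x = x"
    using assms(1) unfolding equivalent_covers_def by blast
  obtain f where f: "f \<in> fat_nbrs h x" "f \<in> fat_nbrs h y" "f \<in> fat_nbrs h z"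
    using assms(6) unfolding joined_def by blast
  have "\<phi> f \<in> fat_nbrs h' u" if "u \<in> slim g" "f \<in> fat_nbrs h u" for u
  proof -
    have "f \<in> fat h" "adj h u f" using that(2) unfolding fat_nbrs_def by auto
    moreover have "\<phi> u = u" using id that(1) unfolding verts_def by blast
    ultimately show ?thesis
      using iso that(1) assms(2) unfolding hoffman_iso_def verts_def fat_nbrs_def by auto
  qed
  then show ?thesis using f assms(3-5) by (auto intro: joinedI)
qed

lemma agree_on_if_unique_strict_cover:
  assumes "unique_strict_cover \<K> g" "strict_cover \<K> g h" "strict_cover \<K> g h'"
  shows "agree_on (slim g) (fat_nbrs h) (fat_nbrs h')"
proof -
  have "equivalent_covers g h h'" "equivalent_covers g h' h" "slim h = slim g" "slim h' = slim g"
    using assms unfolding unique_strict_cover_def strict_cover_def by auto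
  then show ?thesis
    unfolding agree_on_def using joined_if_equivalent[of g h h'] joined_if_equivalent[of g h' h]
    by blast
qed

lemma unique_strict_cover_if_deletions:
  fixes \<H> :: "'a::infinite hoffman set"
  assumes H: "\<H> \<subseteq> family_O" and g: "slim_line_graph \<H> g" "connected_graph g" "card (verts g) \<ge> 4"
    and del: "\<And>g'. slim_line_graph \<H> g' \<Longrightarrow> connected_graph g' \<Longrightarrow>
      Suc (card (verts g')) = card (verts g) \<Longrightarrow> unique_strict_cover (family_bar \<H>) g'"
  shows "unique_strict_cover (family_bar \<H>) g"
proof -
  let ?V = "slim g" and ?E = "edges g"
  obtain k where k: "cover \<H> g k"
    using g(1) unfolding slim_line_graph_def line_hoffman_graph_def by blast
  have sg: "slim_graph g" and hg: "hoffman_graph g" and fat: "fat g = {}"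
    using g(1) unfolding slim_line_graph_def slim_graph_def by auto
  have V: "verts g = ?V" using fat by (simp add: verts_def)
  have fin: "finite ?V" and sym: "sym ?E" and irr: "irrefl ?E" and E: "?E \<subseteq> ?V \<times> ?V"
    using hg unfolding hoffman_graph_def V by auto
  have "?E \<inter> ?V \<times> ?V = ?E" using E by blast
  then have conn: "connected_on ?E ?V" using g(2) unfolding connected_graph_def connected_on_def V by simp
  have card: "card ?V \<ge> 4" using g(3) V by simp
  have nbr: "\<exists>y\<in>?V. (x, y) \<in> ?E" if "x \<in> ?V" for x
  proof -
    have "?V \<noteq> {x}" using card by auto
    then have "{x} \<subset> ?V" using that by blast
    then obtain u v where "u \<in> {x}" "v \<in> ?V - {x}" "(u, v) \<in> ?E"
      by (rule connected_on_edge_out[OF conn]) auto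
    then show ?thesis by blast
  qed
  have barO: "family_bar \<H> \<subseteq> family_O" by (rule family_bar_subset_O)
  have agree_del: "agree_on (?V - {v}) (fat_nbrs h) (fat_nbrs h')"
    if h: "strict_cover (family_bar \<H>) g h" and h': "strict_cover (family_bar \<H>) g h'"
      and v: "v \<in> ?V" "connected_on ?E (?V - {v})" for h h' v
  proof -
    define g' where "g' = induced g (?V - {v}) {}"
    have slim': "slim g' = ?V - {v}" and verts': "verts g' = ?V - {v}" and fat': "fat g' = {}"
      and edges': "edges g' = ?E \<inter> (?V - {v}) \<times> (?V - {v})"
      by (auto simp: g'_def)
    have sub: "hoffman_subgraph g' g"
      unfolding g'_def by (intro hoffman_subgraph_induced hg) auto
    have sub_trans: "hoffman_subgraph g' l" if "hoffman_subgraph g l" for l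
      using sub that unfolding hoffman_subgraph_def verts' V edges' slim' fat' by auto
    then have cov: "cover \<K> g' l" if "cover \<K> g l" for \<K> l
      using that unfolding cover_def by blast
    have sg': "slim_graph g'" using sub fat' unfolding slim_graph_def hoffman_subgraph_def by blast
    have "slim_line_graph \<H> g'"
      using cov[OF k] sg' unfolding slim_line_graph_def line_hoffman_graph_def by blast
    moreover have "connected_graph g'"
      using v(2) unfolding connected_graph_def connected_on_def verts' edges' .
    moreover have "Suc (card (verts g')) = card (verts g)"
      using v(1) fin unfolding verts' V by (rule card_Suc_Diff1[rotated])
    ultimately have uniq: "unique_strict_cover (family_bar \<H>) g'" by (rule del)
    \<comment> \<open>As a cover of \<open>g'\<close>, \<open>h\<close> is not strict, since
      \<open>v\<close> is still slim in it. It is therefore replaced by a strict cover with the same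
      triples, to which uniqueness for \<open>g'\<close> applies.\<close>
    obtain l where l: "strict_cover (family_bar \<H>) g' l" "agree_on (slim g') (fat_nbrs l) (fat_nbrs h)"
      using ex_strict_cover[OF H cov _ sg', of "family_bar \<H>" h] h unfolding strict_cover_def by blast
    obtain l' where l': "strict_cover (family_bar \<H>) g' l'" "agree_on (slim g') (fat_nbrs l') (fat_nbrs h')"
      using ex_strict_cover[OF H cov _ sg', of "family_bar \<H>" h'] h' unfolding strict_cover_def by blast
    show ?thesis
      using agree_on_if_unique_strict_cover[OF uniq l(1) l'(1)] l(2) l'(2)
      unfolding slim' agree_on_def by simp
  qed
  have agreeing: "agreeing_systems ?V ?E (fat_nbrs h) (fat_nbrs h')"
    if h: "strict_cover (family_bar \<H>) g h" and h': "strict_cover (family_bar \<H>) g h'" for h h'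
  proof -
    have cov: "cover (family_bar \<H>) g h" "cover (family_bar \<H>) g h'" and sl: "slim h' = ?V"
      using h h' unfolding strict_cover_def by auto
    note sys = cover_fat_system(1)[OF cov(1) barO fat] cover_fat_system(1)[OF cov(2) barO fat]
    have "agree_on ?V (fat_nbrs h) (fat_nbrs h')"
      using agree_on_if_agree_on_deletions[OF sys sym irr conn card] agree_del[OF h h'] by blast
    then show ?thesis
      using sys irr nbr cover_fat_system(3)[OF cov(2) barO fat sl]
      by (intro agreeing_systems.intro agreeing_systems_axioms.intro) auto
  qed
  have "equivalent_covers g h h'"
    if h: "strict_cover (family_bar \<H>) g h" and h': "strict_cover (family_bar \<H>) g h'" for h h'
    using equivalent_covers_if_agree[OF _ _ _ _ fat agreeing[OF h h'] agreeing[OF h' h]] h h'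
    unfolding strict_cover_def cover_def by blast
  moreover obtain l where "strict_cover (family_bar \<H>) g l"
    using ex_strict_cover[OF H k _ sg] by blast
  ultimately show ?thesis unfolding unique_strict_cover_def by blast
qed

theorem theorem1p4:
  fixes \<H> :: "'a::infinite hoffman set" and N :: nat
  assumes "\<H> \<subseteq> family_O"
    and "\<exists>h. is_h2 h \<and> in_family h \<H>"
    and "N \<ge> 7"
    and "\<And>g. slim_line_graph \<H> g \<Longrightarrow> connected_graph g \<Longrightarrow> card (verts g) = N \<Longrightarrow>
           unique_strict_cover (family_bar \<H>) g"
  shows "\<forall>g. slim_line_graph \<H> g \<longrightarrow> connected_graph g \<longrightarrow> card (verts g) \<ge> N \<longrightarrow>
           unique_strict_cover (family_bar \<H>) g"
proof -
  have "unique_strict_cover (family_bar \<H>) g"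
    if "n \<ge> N" "slim_line_graph \<H> g" "connected_graph g" "card (verts g) = n" for n g
    using that
  proof (induction n arbitrary: g rule: nat_induct_at_least)
    case base
    then show ?case using assms(4) by blast
  next
    case (Suc n)
    show ?case
    proof (rule unique_strict_cover_if_deletions[OF assms(1) Suc.prems(1,2)])
      show "card (verts g) \<ge> 4" using Suc.prems(3) Suc.hyps assms(3) by linarith
      fix g' assume "slim_line_graph \<H> g'" "connected_graph g'"
        and "Suc (card (verts g')) = card (verts g)"
      then show "unique_strict_cover (family_bar \<H>) g'" using Suc.IH Suc.prems(3) by simp
    qed
  qed
  then show ?thesis by blast
qed

end
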